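(* There exists an algorithm which, given as input a finite presentation $\langle a_1,\dots,a_n \mid r_1,\dots,r_m\rangle$ of a finitely generated nilpotent group $G$ of class $c \ge 1$ (it is promised that the presented group is nilpotent of some class $c\geq 1$), a pair of endomorphisms $\varphi,\psi \in \mathrm{End}(G)$, and a pair of elements $u,v\in G$, decides whether or not $u$ and $v$ are $\varphi,\psi$-twisted conjugate, i.e. whether or not there exists $x\in G$ such that $(x\varphi)\,u = v\,(x\psi)$.
   Context: Endomorphisms are written on the right: $x\varphi$ denotes the image of $x\in G$ under $\varphi\in\mathrm{End}(G)$. For a group $G$ and a pair of endomorphisms $\varphi,\psi\in \mathrm{End}(G)$, elements $u,v\in G$ are called $\varphi,\psi$-twisted conjugate if there exists $x\in G$ with $(x\varphi)u = v(x\psi)$. The twisted conjugacy problem for pairs of endomorphisms is to decide, for given $\varphi,\psi,u,v$, whether $u$ and $v$ are $\varphi,\psi$-twisted conjugate. Input conventions: elements of $G$ are given as words in the generators $a_1,\dots,a_n$ and their inverses; an endomorphism is given by words representing the images of $a_1,\dots,a_n$ (it is promised that these images define an endomorphism of $G$). "Algorithm" means a procedure computable in the usual sense (Turing machine / recursive function) that terminates with the correct answer on every input satisfying the promises. *)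

theory Defs
  imports "HOL-Algebra.Generated_Groups" "HOL-Library.Nat_Bijection"
begin

text \<open>
  An algorithm is a program for a partial recursive (\<open>\<mu>\<close>-recursive) function. Arities are implicit:
  \<open>computes f xs y\<close> says that the program \<open>f\<close> halts on the argument tuple \<open>xs\<close> with result \<open>y\<close>.
  \<open>Zero\<close> is the zero function of every arity, and a program that does not fit the length of its
  argument tuple does not halt on it. Primitive recursion and minimisation act on the first argument.
\<close>

datatype recf =
    Zero
  | Succ
  | Proj nat
  | Comp recf "recf list"
  | PrimRec recf recf
  | Mu recf

inductive computes :: "recf \<Rightarrow> nat list \<Rightarrow> nat \<Rightarrow> bool" where
  zero: "computes Zero xs 0"
| succ: "computes Succ [x] (Suc x)"
| proj: "i < length xs \<Longrightarrow> computes (Proj i) xs (xs ! i)"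
| comp: "\<lbrakk>list_all2 (\<lambda>g y. computes g xs y) gs ys; computes f ys z\<rbrakk> \<Longrightarrow> computes (Comp f gs) xs z"
| primrec_0: "computes f xs y \<Longrightarrow> computes (PrimRec f g) (0 # xs) y"
| primrec_Suc: "\<lbrakk>computes (PrimRec f g) (k # xs) y; computes g (k # y # xs) z\<rbrakk>
    \<Longrightarrow> computes (PrimRec f g) (Suc k # xs) z"
| mu: "\<lbrakk>computes f (k # xs) 0; \<forall>j<k. \<exists>y. computes f (j # xs) (Suc y)\<rbrakk>
    \<Longrightarrow> computes (Mu f) xs k"
monos list_all2_mono

inductive_cases computes_ZeroE: "computes Zero xs y"
inductive_cases computes_SuccE: "computes Succ xs y"
inductive_cases computes_ProjE: "computes (Proj i) xs y"
inductive_cases computes_CompE: "computes (Comp f gs) xs y"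
inductive_cases computes_PrimRec_0E: "computes (PrimRec f g) (0 # xs) y"
inductive_cases computes_PrimRec_SucE: "computes (PrimRec f g) (Suc k # xs) y"
inductive_cases computes_MuE: "computes (Mu f) xs y"

lemma computes_deterministic:
  "computes f xs y \<Longrightarrow> computes f xs z \<Longrightarrow> y = z"
proof (induction arbitrary: z rule: computes.induct)
  case (zero xs)
  then show ?case by (auto elim: computes_ZeroE)
next
  case (succ x)
  then show ?case by (auto elim: computes_SuccE)
next
  case (proj i xs)
  then show ?case by (auto elim: computes_ProjE)
next
  case (comp xs gs ys f z z')
  from comp.prems obtain ys' where
    ys': "list_all2 (\<lambda>g y. computes g xs y) gs ys'" and z': "computes f ys' z'"
    by (auto elim: computes_CompE)
  have "ys = ys'"
    using comp.IH(1) ys' by (auto simp: list_all2_conv_all_nth intro!: nth_equalityI)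
  with z' have "computes f ys z'" by simp
  then show ?case by (rule comp.IH)
next
  case (primrec_0 f xs y g)
  from primrec_0.prems show ?case
    by (rule computes_PrimRec_0E) (rule primrec_0.IH)
next
  case (primrec_Suc f g k xs y z z')
  from primrec_Suc.prems show ?case
  proof (rule computes_PrimRec_SucE)
    fix y' assume y': "computes (PrimRec f g) (k # xs) y'" "computes g (k # y' # xs) z'"
    have "y = y'" using y'(1) by (rule primrec_Suc.IH)
    with y'(2) have "computes g (k # y # xs) z'" by simp
    then show "z = z'" by (rule primrec_Suc.IH)
  qed
next
  case (mu f k xs k')
  from mu.prems have k': "computes f (k' # xs) 0"
    and below: "\<forall>j<k'. \<exists>y. computes f (j # xs) (Suc y)"
    by (auto elim: computes_MuE)
  show ?case
  proof (rule linorder_cases)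
    assume "k < k'"
    with below obtain y where "computes f (k # xs) (Suc y)" by blast
    then have "0 = Suc y" by (rule mu.IH)
    then show ?thesis by simp
  next
    assume "k' < k"
    with mu.IH(2) obtain y where "\<forall>z. computes f (k' # xs) z \<longrightarrow> Suc y = z" by blast
    with k' have "Suc y = 0" by blast
    then show ?thesis by simp
  qed simp
qed

text \<open>\<open>Pos i\<close> is the generator \<open>a\<^sub>i\<^sub>+\<^sub>1\<close> and \<open>Neg i\<close> is its formal inverse.\<close>

datatype letter = Pos nat | Neg nat

type_synonym word = "letter list"

fun inv_letter :: "letter \<Rightarrow> letter" where
  "inv_letter (Pos i) = Neg i"
| "inv_letter (Neg i) = Pos i"

definition letters :: "nat \<Rightarrow> letter set" where
  "letters n = Pos ` {..<n} \<union> Neg ` {..<n}"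

abbreviation words :: "nat \<Rightarrow> word set" where
  "words n \<equiv> lists (letters n)"

text \<open>
  Two words represent the same element of the presented group iff one can be transformed into the
  other by inserting and deleting subwords \<open>a a\<^sup>-\<^sup>1\<close>, \<open>a\<^sup>-\<^sup>1 a\<close> and relators.
\<close>

inductive_set pres_rel :: "nat \<Rightarrow> word set \<Rightarrow> (word \<times> word) set"
  for n :: nat and R :: "word set" where
  refl: "u \<in> words n \<Longrightarrow> (u, u) \<in> pres_rel n R"
| sym: "(u, v) \<in> pres_rel n R \<Longrightarrow> (v, u) \<in> pres_rel n R"
| trans: "\<lbrakk>(u, v) \<in> pres_rel n R; (v, w) \<in> pres_rel n R\<rbrakk> \<Longrightarrow> (u, w) \<in> pres_rel n R"
| cancel: "\<lbrakk>u \<in> words n; v \<in> words n; a \<in> letters n\<rbrakk>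
    \<Longrightarrow> (u @ [a, inv_letter a] @ v, u @ v) \<in> pres_rel n R"
| relator: "\<lbrakk>u \<in> words n; v \<in> words n; r \<in> R; r \<in> words n\<rbrakk>
    \<Longrightarrow> (u @ r @ v, u @ v) \<in> pres_rel n R"

definition word_class :: "nat \<Rightarrow> word set \<Rightarrow> word \<Rightarrow> word set" where
  "word_class n R w = pres_rel n R `` {w}"

definition presented_group :: "nat \<Rightarrow> word set \<Rightarrow> word set monoid" where
  "presented_group n R =
     \<lparr>carrier = words n // pres_rel n R,
      mult = (\<lambda>A B. \<Union>u\<in>A. \<Union>v\<in>B. word_class n R (u @ v)),
      one = word_class n R []\<rparr>"

lemma inv_letter_inv_letter [simp]: "inv_letter (inv_letter a) = a"
  by (cases a) auto

lemma inv_letter_in_letters [simp]: "inv_letter a \<in> letters n \<longleftrightarrow> a \<in> letters n"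
  by (cases a) (auto simp: letters_def)

lemma pres_rel_in_words:
  "(u, v) \<in> pres_rel n R \<Longrightarrow> u \<in> words n \<and> v \<in> words n"
  by (induction rule: pres_rel.induct) auto

lemma equiv_pres_rel: "equiv (words n) (pres_rel n R)"
proof (rule equivI)
  show "pres_rel n R \<subseteq> words n \<times> words n"
    using pres_rel_in_words by fast
  show "refl_on (words n) (pres_rel n R)"
    by (rule refl_onI) (auto intro: pres_rel.refl)
  show "sym (pres_rel n R)" by (blast intro: symI pres_rel.sym)
  show "trans (pres_rel n R)" by (blast intro: transI pres_rel.trans)
qed

lemma pres_rel_append_context:
  assumes "(u, v) \<in> pres_rel n R" "p \<in> words n" "q \<in> words n"
  shows "(p @ u @ q, p @ v @ q) \<in> pres_rel n R"
  using assms
proof (induction rule: pres_rel.induct)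
  case (refl u)
  then show ?case by (intro pres_rel.refl) simp
next
  case (cancel u v a)
  then show ?case using pres_rel.cancel[of "p @ u" n "v @ q" a R] by simp
next
  case (relator u v r)
  then show ?case using pres_rel.relator[of "p @ u" n "v @ q" r R] by simp
qed (blast intro: pres_rel.sym pres_rel.trans)+

lemma pres_rel_append:
  assumes "(u, u') \<in> pres_rel n R" "(v, v') \<in> pres_rel n R"
  shows "(u @ v, u' @ v') \<in> pres_rel n R"
proof -
  note w = assms[THEN pres_rel_in_words]
  have "(u @ v, u' @ v) \<in> pres_rel n R"
    using pres_rel_append_context[OF assms(1), of "[]" v] w by simp
  moreover have "(u' @ v, u' @ v') \<in> pres_rel n R"
    using pres_rel_append_context[OF assms(2), of u' "[]"] w by simp
  ultimately show ?thesis by (rule pres_rel.trans)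
qed

lemma word_class_eq_iff:
  assumes "u \<in> words n" "v \<in> words n"
  shows "word_class n R u = word_class n R v \<longleftrightarrow> (u, v) \<in> pres_rel n R"
  using eq_equiv_class_iff[OF equiv_pres_rel assms] by (simp add: word_class_def)

lemma carrier_presented_group: "carrier (presented_group n R) = word_class n R ` words n"
  by (auto simp: presented_group_def quotient_def word_class_def)

lemma one_presented_group: "\<one>\<^bsub>presented_group n R\<^esub> = word_class n R []"
  by (simp add: presented_group_def)

lemma mult_word_class:
  assumes "u \<in> words n" "v \<in> words n"
  shows "word_class n R u \<otimes>\<^bsub>presented_group n R\<^esub> word_class n R v = word_class n R (u @ v)"
proof -
  have "word_class n R (u' @ v') = word_class n R (u @ v)"
    if "u' \<in> word_class n R u" "v' \<in> word_class n R v" for u' v'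
  proof -
    from that have "(u, u') \<in> pres_rel n R" "(v, v') \<in> pres_rel n R"
      by (auto simp: word_class_def)
    then have "(u @ v, u' @ v') \<in> pres_rel n R" by (rule pres_rel_append)
    then show ?thesis
      unfolding word_class_def by (rule equiv_class_eq[OF equiv_pres_rel, symmetric])
  qed
  then have "(\<Union>u'\<in>word_class n R u. \<Union>v'\<in>word_class n R v. word_class n R (u' @ v')) =
      (\<Union>u'\<in>word_class n R u. \<Union>v'\<in>word_class n R v. word_class n R (u @ v))"
    by (intro SUP_cong) simp_all
  moreover have "u \<in> word_class n R u" "v \<in> word_class n R v"
    using assms by (simp_all add: word_class_def pres_rel.refl)
  then have "word_class n R u \<noteq> {}" "word_class n R v \<noteq> {}" by blast+
  ultimately show ?thesis
    by (simp add: presented_group_def)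
qed

lemma inv_word_left:
  "u \<in> words n \<Longrightarrow> (rev (map inv_letter u) @ u, []) \<in> pres_rel n R"
proof (induction u)
  case Nil
  show ?case by (auto intro: pres_rel.refl)
next
  case (Cons a u)
  have inv_in: "rev (map inv_letter u) \<in> words n"
    using Cons.prems by (auto simp: in_lists_conv_set)
  have "(rev (map inv_letter u) @ [inv_letter a, inv_letter (inv_letter a)] @ u,
      rev (map inv_letter u) @ u) \<in> pres_rel n R"
    using Cons.prems inv_in by (intro pres_rel.cancel) auto
  then have "(rev (map inv_letter (a # u)) @ a # u, rev (map inv_letter u) @ u) \<in> pres_rel n R"
    by simp
  from pres_rel.trans[OF this] Cons show ?case by auto
qed

lemma group_presented_group: "group (presented_group n R)"
proof (rule groupI)
  show "x \<otimes>\<^bsub>presented_group n R\<^esub> y \<in> carrier (presented_group n R)"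
    if "x \<in> carrier (presented_group n R)" "y \<in> carrier (presented_group n R)" for x y
    using that unfolding carrier_presented_group
    by (elim imageE) (simp add: mult_word_class)
  show "\<one>\<^bsub>presented_group n R\<^esub> \<in> carrier (presented_group n R)"
    by (simp add: carrier_presented_group one_presented_group)
  show "x \<otimes>\<^bsub>presented_group n R\<^esub> y \<otimes>\<^bsub>presented_group n R\<^esub> z =
      x \<otimes>\<^bsub>presented_group n R\<^esub> (y \<otimes>\<^bsub>presented_group n R\<^esub> z)"
    if "x \<in> carrier (presented_group n R)" "y \<in> carrier (presented_group n R)"
      "z \<in> carrier (presented_group n R)" for x y z
    using that unfolding carrier_presented_group
    by (elim imageE) (simp add: mult_word_class)
  show "\<one>\<^bsub>presented_group n R\<^esub> \<otimes>\<^bsub>presented_group n R\<^esub> x = x"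
    if "x \<in> carrier (presented_group n R)" for x
    using that unfolding carrier_presented_group one_presented_group
    by (elim imageE) (simp add: mult_word_class)
next
  fix x assume "x \<in> carrier (presented_group n R)"
  then obtain u where u: "u \<in> words n" "x = word_class n R u"
    by (auto simp: carrier_presented_group)
  have inv_in: "rev (map inv_letter u) \<in> words n"
    using u by (auto simp: in_lists_conv_set)
  have "word_class n R (rev (map inv_letter u)) \<otimes>\<^bsub>presented_group n R\<^esub> x = \<one>\<^bsub>presented_group n R\<^esub>"
    using u inv_in inv_word_left[of u n R]
    by (simp add: mult_word_class one_presented_group word_class_eq_iff)
  then show "\<exists>y\<in>carrier (presented_group n R). y \<otimes>\<^bsub>presented_group n R\<^esub> x = \<one>\<^bsub>presented_group n R\<^esub>"
    using inv_in by (auto simp: carrier_presented_group)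
qed

text \<open>
  \<open>lower_central G i\<close> is \<open>\<gamma>\<^sub>i\<^sub>+\<^sub>1(G)\<close>, so that a group is of class \<open>c\<close> iff \<open>c\<close> is the least index at
  which it becomes trivial. In particular, the groups of class 0 are the trivial ones.
\<close>

primrec lower_central :: "('a, 'b) monoid_scheme \<Rightarrow> nat \<Rightarrow> 'a set" where
  "lower_central G 0 = carrier G"
| "lower_central G (Suc i) = generate G
     (\<Union>h\<in>lower_central G i. \<Union>g\<in>carrier G. {h \<otimes>\<^bsub>G\<^esub> g \<otimes>\<^bsub>G\<^esub> inv\<^bsub>G\<^esub> h \<otimes>\<^bsub>G\<^esub> inv\<^bsub>G\<^esub> g})"

definition nilpotent_of_class :: "('a, 'b) monoid_scheme \<Rightarrow> nat \<Rightarrow> bool" where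
  "nilpotent_of_class G c \<longleftrightarrow>
     group G \<and> lower_central G c = {\<one>\<^bsub>G\<^esub>} \<and> (\<forall>i<c. lower_central G i \<noteq> {\<one>\<^bsub>G\<^esub>})"

definition twisted_conjugate ::
  "('a, 'b) monoid_scheme \<Rightarrow> ('a \<Rightarrow> 'a) \<Rightarrow> ('a \<Rightarrow> 'a) \<Rightarrow> 'a \<Rightarrow> 'a \<Rightarrow> bool" where
  "twisted_conjugate G \<phi> \<psi> u v \<longleftrightarrow> (\<exists>x\<in>carrier G. \<phi> x \<otimes>\<^bsub>G\<^esub> u = v \<otimes>\<^bsub>G\<^esub> \<psi> x)"

definition endo_given_by :: "nat \<Rightarrow> word set \<Rightarrow> word list \<Rightarrow> (word set \<Rightarrow> word set) \<Rightarrow> bool" where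
  "endo_given_by n R ws \<phi> \<longleftrightarrow>
     length ws = n \<and> set ws \<subseteq> words n \<and>
     \<phi> \<in> hom (presented_group n R) (presented_group n R) \<and>
     (\<forall>i<n. \<phi> (word_class n R [Pos i]) = word_class n R (ws ! i))"

fun letter_code :: "letter \<Rightarrow> nat" where
  "letter_code (Pos i) = 2 * i"
| "letter_code (Neg i) = 2 * i + 1"

definition word_code :: "word \<Rightarrow> nat" where
  "word_code w = list_encode (map letter_code w)"

definition words_code :: "word list \<Rightarrow> nat" where
  "words_code ws = list_encode (map word_code ws)"

end

theory Submission
  imports Defs
begin

text \<open>
  Twisted conjugacy classes are recursively enumerable, so it suffices to enumerate the pairs that are
  not twisted conjugate, and for this that every such pair \<open>u, v\<close> is separated in a finite quotient: there
  is a normal subgroup \<open>N\<close> of finite index such that \<open>(x\<phi>) u\<close> and \<open>v (x\<psi>)\<close> are different modulo \<open>N\<close> for all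
  \<open>x\<close>. Here \<open>N\<close> need not be invariant under \<open>\<phi>\<close> and \<open>\<psi>\<close>. A finitely generated nilpotent group has a
  descending series of normal subgroups whose factors are cyclic and central, and separation is proved
  by induction along it, simultaneously for all subgroups over which \<open>x\<close> may range: if the classes
  meet modulo the larger term, then translation makes \<open>v\<close> central modulo the smaller one, and on the
  elements on which both maps agree modulo the larger term, \<open>x \<mapsto> (x\<phi>) (x\<psi>)\<^sup>-\<^sup>1\<close> is a homomorphism to
  the centre modulo the smaller one, so that residual finiteness applies.
\<close>

section \<open>Recursive functions and enumerable predicates\<close>

text \<open>Since \<open>N\<close> need not be invariant, \<phi> and \<psi> need not induce maps on
  \<open>G/N\<close>, and running through the finitely many residues of \<open>x\<close> modulo
  \<open>N\<close> would decide nothing. A separation is nevertheless checkable, because twisted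
  conjugacy on \<open>G\<close> is generated by finitely many moves, from
  \<open>(a\<^sub>i\<phi>) w\<close> to \<open>w (a\<^sub>i\<psi>)\<close>: a certificate is a
  finite multiplication table with a colouring of its elements that respects the moves and tells
  \<open>u\<close> from \<open>v\<close>. The same moves, together with the relations, enumerate the
  positive answers. Both searches thus handle words only and presuppose no solution of the word
  problem. The range of \<open>x\<close> has to vary in the induction because the hypothesis is also
  applied to a subgroup of finite index in the current range, and \<phi> and \<psi> need not map it
  into itself. Hence both maps go from a fixed group \<open>D\<close> to \<open>G\<close>, and
  \<open>x\<close> ranges over a subgroup \<open>K\<close> of \<open>D\<close>.\<close>

text \<open>A tuple of arguments is passed as one iterated pair, so that a quantifier pushes its variable
  onto the argument.\<close>

definition recursive :: "(nat \<Rightarrow> nat) \<Rightarrow> bool" where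
  "recursive f \<longleftrightarrow> (\<exists>p. \<forall>e. computes p [e] (f e))"

definition recursive2 :: "(nat \<Rightarrow> nat \<Rightarrow> nat) \<Rightarrow> bool" where
  "recursive2 f \<longleftrightarrow> (\<exists>p. \<forall>x y. computes p [x, y] (f x y))"

lemma computes_Comp1:
  "computes g xs y \<Longrightarrow> computes f [y] z \<Longrightarrow> computes (Comp f [g]) xs z"
  by (rule computes.comp[where ys = "[y]"]) simp_all

lemma computes_Comp2:
  "computes g xs y \<Longrightarrow> computes h xs y' \<Longrightarrow> computes f [y, y'] z \<Longrightarrow> computes (Comp f [g, h]) xs z"
  by (rule computes.comp[where ys = "[y, y']"]) simp_all

lemma computes_Proj: "i < length xs \<Longrightarrow> y = xs ! i \<Longrightarrow> computes (Proj i) xs y"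
  by (simp add: computes.proj)

lemma recursive_compose: "recursive f \<Longrightarrow> recursive g \<Longrightarrow> recursive (\<lambda>e. f (g e))"
  unfolding recursive_def by (blast intro: computes_Comp1)

lemma recursive2_compose:
  "recursive2 f \<Longrightarrow> recursive g \<Longrightarrow> recursive h \<Longrightarrow> recursive (\<lambda>e. f (g e) (h e))"
  unfolding recursive_def recursive2_def by (blast intro: computes_Comp2)

lemma recursive_id: "recursive (\<lambda>e. e)"
  unfolding recursive_def by (intro exI[of _ "Proj 0"] allI computes_Proj) simp_all

lemma recursive_Suc: "recursive f \<Longrightarrow> recursive (\<lambda>e. Suc (f e))"
  by (rule recursive_compose[of Suc]) (auto simp: recursive_def intro: computes.succ)

lemma recursive_const: "recursive (\<lambda>_. k)"
proof (induction k)
  case 0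
  show ?case unfolding recursive_def by (blast intro: computes.zero)
qed (rule recursive_Suc)

lemma computes_PrimRec:
  assumes "computes f xs a" "\<And>k y. computes g (k # y # xs) (G k y)"
  shows "computes (PrimRec f g) (k # xs) (rec_nat a G k)"
  by (induction k) (use assms in \<open>auto intro: computes.primrec_0 computes.primrec_Suc\<close>)

lemma recursive2_add: "recursive2 (+)"
proof -
  have "computes (PrimRec (Proj 0) (Comp Succ [Proj 1])) [x, y] (x + y)" for x y
  proof -
    have "computes (PrimRec (Proj 0) (Comp Succ [Proj 1])) [x, y] (rec_nat y (\<lambda>_. Suc) x)"
      by (rule computes_PrimRec[OF computes_Proj computes_Comp1[OF computes_Proj computes.succ]]) simp_all
    moreover have "rec_nat y (\<lambda>_. Suc) x = x + y" by (induction x) auto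
    ultimately show ?thesis by simp
  qed
  then show ?thesis unfolding recursive2_def by blast
qed

lemmas recursive_add = recursive2_compose[OF recursive2_add]

lemma recursive_pred: "recursive f \<Longrightarrow> recursive (\<lambda>e. f e - 1)"
proof (rule recursive_compose[of "\<lambda>e. e - 1"])
  have "computes (PrimRec Zero (Proj 0)) [x] (x - 1)" for x
  proof -
    have "computes (PrimRec Zero (Proj 0)) [x] (rec_nat 0 (\<lambda>k y. k) x)"
      by (rule computes_PrimRec[OF computes.zero computes_Proj]) simp_all
    then show ?thesis by (cases x) auto
  qed
  then show "recursive (\<lambda>e. e - 1)" unfolding recursive_def by blast
qed

lemma recursive2_diff: "recursive2 (-)"
proof -
  obtain p where p: "\<And>x. computes p [x] (x - 1)"
    using recursive_pred[OF recursive_id] unfolding recursive_def by blast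
  let ?sub = "PrimRec (Proj 0) (Comp p [Proj 1])"
  have "computes ?sub [y, x] (x - y)" for x y
  proof -
    have "computes ?sub [y, x] (rec_nat x (\<lambda>_ z. z - 1) y)"
      by (rule computes_PrimRec[OF computes_Proj computes_Comp1[OF computes_Proj p]]) simp_all
    moreover have "rec_nat x (\<lambda>_ z. z - 1) y = x - y" by (induction y) auto
    ultimately show ?thesis by simp
  qed
  \<comment> \<open>Recursion runs over the subtrahend, so \<open>?sub\<close> takes it first; the
    projections restore the order of the arguments.\<close>
  then have "computes (Comp ?sub [Proj 1, Proj 0]) [x, y] (x - y)" for x y
    by (auto intro!: computes_Comp2 computes_Proj)
  then show ?thesis unfolding recursive2_def by blast
qed

lemmas recursive_diff = recursive2_compose[OF recursive2_diff]

lemma recursive_triangle: "recursive f \<Longrightarrow> recursive (\<lambda>e. triangle (f e))"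
proof (rule recursive_compose[of triangle])
  obtain p where p: "\<And>x y. computes p [x, y] (x + y)"
    using recursive2_add unfolding recursive2_def by blast
  have "computes (PrimRec Zero (Comp p [Proj 1, Comp Succ [Proj 0]])) [x] (rec_nat 0 (\<lambda>k y. y + Suc k) x)" for x
    by (rule computes_PrimRec[OF computes.zero
          computes_Comp2[OF computes_Proj computes_Comp1[OF computes_Proj computes.succ] p]]) simp_all
  moreover have "rec_nat 0 (\<lambda>k y. y + Suc k) x = triangle x" for x by (induction x) auto
  ultimately show "recursive triangle" unfolding recursive_def by metis
qed

lemma recursive2_prod_encode: "recursive2 (\<lambda>x y. prod_encode (x, y))"
proof -
  obtain p q where p: "\<And>x y. computes p [x, y] (x + y)" and q: "\<And>x. computes q [x] (triangle x)"
    using recursive2_add recursive_triangle[OF recursive_id] unfolding recursive_def recursive2_def by blast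
  have "computes (Comp p [Comp q [p], Proj 0]) [x, y] (prod_encode (x, y))" for x y
    unfolding prod_encode_def by (auto intro!: computes_Proj computes_Comp2 computes_Comp1 p q)
  then show ?thesis unfolding recursive2_def by blast
qed

lemmas recursive_pair = recursive2_compose[OF recursive2_prod_encode]

lemma computes_Mu:
  assumes "\<And>k. computes f (k # xs) (F k)" "F m = 0" "\<And>j. j < m \<Longrightarrow> F j \<noteq> 0"
  shows "computes (Mu f) xs m"
proof (rule computes.mu)
  show "computes f (m # xs) 0" using assms by metis
  show "\<forall>j<m. \<exists>y. computes f (j # xs) (Suc y)"
    using assms by (metis not0_implies_Suc)
qed

section \<open>Projections of pairs and primitive recursion with parameters\<close>

definition pfst :: "nat \<Rightarrow> nat" where "pfst p = fst (prod_decode p)"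
definition psnd :: "nat \<Rightarrow> nat" where "psnd p = snd (prod_decode p)"

lemma pfst_prod_encode [simp]: "pfst (prod_encode (x, y)) = x"
  and psnd_prod_encode [simp]: "psnd (prod_encode (x, y)) = y"
  by (simp_all add: pfst_def psnd_def)

lemma prod_encode_pfst_psnd [simp]: "prod_encode (pfst p, psnd p) = p"
  by (simp add: pfst_def psnd_def)

lemma strict_mono_triangle: "strict_mono triangle"
  by (simp add: strict_mono_Suc_iff)

text \<open>The antidiagonal \<open>x + y = s\<close> occupies the codes from \<open>triangle s\<close> up to, but excluding, \<open>triangle (Suc s)\<close>.\<close>

lemma
  shows recursive_pfst: "recursive f \<Longrightarrow> recursive (\<lambda>e. pfst (f e))"
    and recursive_psnd: "recursive f \<Longrightarrow> recursive (\<lambda>e. psnd (f e))"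
proof -
  define S where "S e = pfst e + psnd e" for e
  have S: "triangle (S e) + pfst e = e" for e
  proof -
    have "prod_encode (pfst e, psnd e) = e" by simp
    then show ?thesis by (simp only: prod_encode_def S_def split)
  qed
  have less: "j < S e \<Longrightarrow> triangle (Suc j) \<le> e" for j e
    using S[of e] monoD[OF strict_mono_mono[OF strict_mono_triangle], of "Suc j" "S e"] by linarith
  have ge: "e < triangle (Suc (S e))" for e
    using S[of e] by (simp add: S_def del: prod_encode_pfst_psnd)
  obtain t where t: "\<And>x. computes t [x] (triangle (Suc x))"
    using recursive_triangle[OF recursive_Suc[OF recursive_id]] unfolding recursive_def by blast
  obtain d where d: "\<And>x y. computes d [x, y] (x - y)"
    using recursive2_diff unfolding recursive2_def by blast
  \<comment> \<open>Truncated subtraction expresses \<open>e < triangle (Suc k)\<close> as a zero,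
    and the least such \<open>k\<close> is the index of the antidiagonal that contains
    \<open>e\<close>.\<close>
  have "computes (Mu (Comp d [Comp Succ [Proj 1], Comp t [Proj 0]])) [e] (S e)" for e
  proof (rule computes_Mu)
    show "computes (Comp d [Comp Succ [Proj 1], Comp t [Proj 0]]) [k, e] (Suc e - triangle (Suc k))" for k
      by (rule computes_Comp2[OF computes_Comp1[OF _ computes.succ] computes_Comp1[OF _ t] d])
        (simp_all add: computes_Proj)
    show "Suc e - triangle (Suc (S e)) = 0" using ge[of e] by simp
    show "Suc e - triangle (Suc j) \<noteq> 0" if "j < S e" for j
      using less[OF that] by simp
  qed
  then have rS: "recursive S" unfolding recursive_def by blast
  have e1: "pfst = (\<lambda>e. e - triangle (S e))"
  proof
    show "pfst e = e - triangle (S e)" for e using S[of e] by linarith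
  qed
  have r1: "recursive pfst"
    by (subst e1) (intro recursive_diff recursive_id recursive_triangle rS)
  have e2: "psnd = (\<lambda>e. S e - pfst e)"
    by (auto simp: S_def)
  have r2: "recursive psnd"
    by (subst e2) (intro recursive_diff rS r1)
  show "recursive f \<Longrightarrow> recursive (\<lambda>e. pfst (f e))" by (rule recursive_compose[OF r1])
  show "recursive f \<Longrightarrow> recursive (\<lambda>e. psnd (f e))" by (rule recursive_compose[OF r2])
qed

text \<open>The parameter \<open>e\<close> is carried along unchanged, and the arguments of the step
  function are packed into one number because \<open>recursive\<close> speaks of unary programs.
  Bounded quantifiers, dropping from lists and the evaluation of words are instances.\<close>

lemma recursive_rec_nat:
  assumes "recursive a" "recursive (\<lambda>e. G (pfst e) (pfst (psnd e)) (psnd (psnd e)))" "recursive b"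
  shows "recursive (\<lambda>e. rec_nat (a e) (\<lambda>k y. G k y e) (b e))"
proof -
  obtain pa pg pb pp where p: "\<And>e. computes pa [e] (a e)" "\<And>e. computes pb [e] (b e)"
    "\<And>e. computes pg [e] (G (pfst e) (pfst (psnd e)) (psnd (psnd e)))"
    "\<And>x y. computes pp [x, y] (prod_encode (x, y))"
    using assms recursive2_prod_encode unfolding recursive_def recursive2_def by metis
  have pg: "computes pg [prod_encode (k, prod_encode (y, e))] (G k y e)" for k y e
    using p(3)[of "prod_encode (k, prod_encode (y, e))"] by simp
  let ?g = "Comp pg [Comp pp [Proj 0, Comp pp [Proj 1, Proj 2]]]"
  have "computes ?g [k, y, e] (G k y e)" for k y e
    by (rule computes_Comp1[OF computes_Comp2[OF _ computes_Comp2[OF _ _ p(4)] p(4)] pg])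
      (simp_all add: computes_Proj)
  then have "computes (PrimRec pa ?g) [k, e] (rec_nat (a e) (\<lambda>k y. G k y e) k)" for k e
    by (rule computes_PrimRec[OF p(1)])
  then have "computes (Comp (PrimRec pa ?g) [pb, Proj 0]) [e] (rec_nat (a e) (\<lambda>k y. G k y e) (b e))" for e
    by (blast intro: computes_Comp2 p(2) computes_Proj[of 0 "[e]" e, simplified])
  then show ?thesis unfolding recursive_def by blast
qed

section \<open>Decidable predicates and bounded quantifiers\<close>

definition decidable :: "(nat \<Rightarrow> bool) \<Rightarrow> bool" where
  "decidable P \<longleftrightarrow> recursive (\<lambda>e. of_bool (P e))"

lemma decidable_compose: "decidable P \<Longrightarrow> recursive f \<Longrightarrow> decidable (\<lambda>e. P (f e))"
  unfolding decidable_def by (rule recursive_compose)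

lemma decidable_eq_0: "recursive f \<Longrightarrow> decidable (\<lambda>e. f e = 0)"
proof -
  assume "recursive f"
  then have "recursive (\<lambda>e. 1 - f e)" by (intro recursive_diff recursive_const)
  moreover have "(\<lambda>e. of_bool (f e = 0)) = (\<lambda>e. 1 - f e)" by auto
  ultimately show ?thesis by (simp add: decidable_def)
qed

lemma decidable_le: "recursive f \<Longrightarrow> recursive g \<Longrightarrow> decidable (\<lambda>e. f e \<le> g e)"
  using decidable_eq_0[OF recursive_diff[of f g]] by simp

lemma decidable_less: "recursive f \<Longrightarrow> recursive g \<Longrightarrow> decidable (\<lambda>e. f e < g e)"
  using decidable_le[OF recursive_Suc] by (simp add: Suc_le_eq)

lemma decidable_not: "decidable P \<Longrightarrow> decidable (\<lambda>e. \<not> P e)"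
  using decidable_eq_0[of "\<lambda>e. of_bool (P e)"] by (simp add: decidable_def)

lemma decidable_disj: "decidable P \<Longrightarrow> decidable Q \<Longrightarrow> decidable (\<lambda>e. P e \<or> Q e)"
  using decidable_not[OF decidable_eq_0[OF recursive_add[of "\<lambda>e. of_bool (P e)" "\<lambda>e. of_bool (Q e)"]]]
  by (simp add: decidable_def)

lemma decidable_conj: "decidable P \<Longrightarrow> decidable Q \<Longrightarrow> decidable (\<lambda>e. P e \<and> Q e)"
  using decidable_not[OF decidable_disj[OF decidable_not decidable_not]] by simp

lemma decidable_eq: "recursive f \<Longrightarrow> recursive g \<Longrightarrow> decidable (\<lambda>e. f e = (g e :: nat))"
  unfolding eq_iff by (intro decidable_conj decidable_le)

lemma recursive_Least:
  assumes "decidable (\<lambda>e. P (pfst e) (psnd e))" "\<And>e. \<exists>k. P k e"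
  shows "recursive (\<lambda>e. LEAST k. P k e)"
proof -
  obtain p pp where p: "\<And>e. computes p [e] (of_bool (\<not> P (pfst e) (psnd e)))"
    "\<And>x y. computes pp [x, y] (prod_encode (x, y))"
    using decidable_not[OF assms(1)] recursive2_prod_encode unfolding decidable_def recursive_def recursive2_def by metis
  have "computes (Mu (Comp p [pp])) [e] (LEAST k. P k e)" for e
  proof (rule computes_Mu)
    show "computes (Comp p [pp]) [k, e] (of_bool (\<not> P k e))" for k
      using computes_Comp1[OF p(2) p(1)] by force
  qed (use assms(2)[of e] in \<open>auto intro: LeastI_ex dest: not_less_Least\<close>)
  then show ?thesis unfolding recursive_def by blast
qed

text \<open>The value is found by unbounded search. A decidable description of the result thus
  replaces a program, as is convenient for \<open>appendc\<close>.\<close>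

lemma recursive_graph:
  assumes "decidable (\<lambda>e. pfst e = f (psnd e))"
  shows "recursive f"
proof -
  have "recursive (\<lambda>e. LEAST k. k = f e)"
    by (rule recursive_Least) (use assms in auto)
  then show ?thesis by (simp add: Least_equality)
qed

lemma decidable_ball:
  assumes "decidable (\<lambda>e. P (pfst e) (psnd e))" "recursive b"
  shows "decidable (\<lambda>e. \<forall>i<b e. P i e)"
proof -
  have "recursive (\<lambda>e. rec_nat 1 (\<lambda>k y. of_bool (y \<noteq> 0 \<and> P k e)) (b e))"
  proof (rule recursive_rec_nat)
    have "decidable (\<lambda>e. P (pfst e) (psnd (psnd e)))"
      using decidable_compose[OF assms(1), of "\<lambda>e. prod_encode (pfst e, psnd (psnd e))"]
      by (simp add: recursive_pair recursive_pfst recursive_psnd recursive_id)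
    then show "recursive (\<lambda>e. of_bool (pfst (psnd e) \<noteq> 0 \<and> P (pfst e) (psnd (psnd e))))"
      unfolding decidable_def[symmetric]
      by (intro decidable_conj decidable_not decidable_eq_0 recursive_pfst recursive_psnd recursive_id)
  qed (intro recursive_const assms)+
  moreover have "rec_nat 1 (\<lambda>k y. of_bool (y \<noteq> 0 \<and> P k e)) k = (of_bool (\<forall>i<k. P i e) :: nat)" for k e
    by (induction k) (auto simp: less_Suc_eq)
  ultimately show ?thesis by (simp add: decidable_def)
qed

section \<open>Recursively enumerable predicates\<close>

definition enumerable :: "(nat \<Rightarrow> bool) \<Rightarrow> bool" where
  "enumerable P \<longleftrightarrow> (\<exists>Q. decidable Q \<and> (\<forall>e. P e \<longleftrightarrow> (\<exists>k. Q (prod_encode (k, e)))))"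

lemma decidable_imp_enumerable: "decidable P \<Longrightarrow> enumerable P"
  unfolding enumerable_def
  by (intro exI[of _ "\<lambda>e. P (psnd e)"]) (simp add: decidable_compose recursive_psnd recursive_id)

lemma enumerable_compose:
  assumes "enumerable P" "recursive f"
  shows "enumerable (\<lambda>e. P (f e))"
proof -
  obtain Q where Q: "decidable Q" "\<And>e. P e \<longleftrightarrow> (\<exists>k. Q (prod_encode (k, e)))"
    using assms(1) unfolding enumerable_def by blast
  have "decidable (\<lambda>e. Q (prod_encode (pfst e, f (psnd e))))"
    by (intro decidable_compose[OF Q(1)] recursive_pair recursive_compose[OF assms(2)] recursive_pfst recursive_psnd recursive_id)
  then show ?thesis
    unfolding enumerable_def by (intro exI[of _ "\<lambda>e. Q (prod_encode (pfst e, f (psnd e)))"]) (simp add: Q(2))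
qed

lemma enumerable_ex:
  assumes "enumerable (\<lambda>e. P (pfst e) (psnd e))"
  shows "enumerable (\<lambda>e. \<exists>k. P k e)"
proof -
  obtain Q where Q: "decidable Q" "\<And>e. P (pfst e) (psnd e) \<longleftrightarrow> (\<exists>k. Q (prod_encode (k, e)))"
    using assms(1) unfolding enumerable_def by blast
  have P: "P k e \<longleftrightarrow> (\<exists>j. Q (prod_encode (j, prod_encode (k, e))))" for k e
    using Q(2)[of "prod_encode (k, e)"] by simp
  let ?R = "\<lambda>e. Q (prod_encode (pfst (pfst e), prod_encode (psnd (pfst e), psnd e)))"
  have "decidable ?R"
    by (intro decidable_compose[OF Q(1)] recursive_pair recursive_pfst recursive_psnd recursive_id)
  moreover have "(\<exists>k. P k e) \<longleftrightarrow> (\<exists>k. ?R (prod_encode (k, e)))" for e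
    unfolding P by (metis pfst_prod_encode psnd_prod_encode)
  ultimately show ?thesis unfolding enumerable_def by blast
qed

lemma enumerable_conj:
  assumes "enumerable P" "enumerable Q"
  shows "enumerable (\<lambda>e. P e \<and> Q e)"
proof -
  obtain P' Q' where *: "decidable P'" "\<And>e. P e \<longleftrightarrow> (\<exists>k. P' (prod_encode (k, e)))"
    "decidable Q'" "\<And>e. Q e \<longleftrightarrow> (\<exists>k. Q' (prod_encode (k, e)))"
    using assms unfolding enumerable_def by blast
  have "enumerable (\<lambda>e. \<exists>k l. P' (prod_encode (k, e)) \<and> Q' (prod_encode (l, e)))"
    by (intro enumerable_ex decidable_imp_enumerable decidable_conj *(1,3)[THEN decidable_compose]
      recursive_pair recursive_pfst recursive_psnd recursive_id)
  then show ?thesis unfolding * by simp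
qed

lemma enumerable_disj:
  assumes "enumerable P" "enumerable Q"
  shows "enumerable (\<lambda>e. P e \<or> Q e)"
proof -
  obtain P' Q' where *: "decidable P'" "\<And>e. P e \<longleftrightarrow> (\<exists>k. P' (prod_encode (k, e)))"
    "decidable Q'" "\<And>e. Q e \<longleftrightarrow> (\<exists>k. Q' (prod_encode (k, e)))"
    using assms unfolding enumerable_def by blast
  have "enumerable (\<lambda>e. \<exists>k. P' (prod_encode (k, e)) \<or> Q' (prod_encode (k, e)))"
    by (intro enumerable_ex decidable_imp_enumerable decidable_disj *(1,3)[THEN decidable_compose]
      recursive_pair recursive_pfst recursive_psnd recursive_id)
  then show ?thesis unfolding * by (simp add: ex_disj_distrib)
qed

text \<open>Lists are read off a code as total sequences, continued by zeros.\<close>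

definition at :: "nat \<Rightarrow> nat \<Rightarrow> nat" where
  "at c i = (if i < length (list_decode c) then list_decode c ! i else 0)"

definition len :: "nat \<Rightarrow> nat" where
  "len c = length (list_decode c)"

lemma len_list_encode [simp]: "len (list_encode xs) = length xs"
  by (simp add: len_def)

lemma at_list_encode [simp]: "i < length xs \<Longrightarrow> at (list_encode xs) i = xs ! i"
  by (simp add: at_def)

lemma
  shows recursive_at: "recursive f \<Longrightarrow> recursive g \<Longrightarrow> recursive (\<lambda>e. at (f e) (g e))"
    and recursive_len: "recursive f \<Longrightarrow> recursive (\<lambda>e. len (f e))"
proof -
  \<comment> \<open>\<open>Suc (prod_encode (x, c))\<close> codes the list with head
    \<open>x\<close> and tail code \<open>c\<close>, so \<open>psnd (y - 1)\<close> passes to the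
    tail. The empty list has code 0, which truncation and \<open>psnd 0 = 0\<close> leave fixed;
    likewise \<open>pfst 0 = 0\<close> supplies the default entry of \<open>at\<close>.\<close>
  define dropc where "dropc c i = rec_nat c (\<lambda>_ y. psnd (y - 1)) i" for c i
  have psnd_0: "psnd 0 = 0"
    using prod_encode_pfst_psnd[of 0] by (metis le_prod_encode_2 le_zero_eq)
  have tl: "psnd (c - 1) = list_encode (tl (list_decode c))" for c
    using psnd_0 by (cases c) (auto simp: psnd_def split: prod.splits)
  have dropc: "dropc c i = list_encode (drop i (list_decode c))" for c i
    unfolding dropc_def by (induction i) (auto simp: tl[simplified] drop_Suc tl_drop)
  have rd: "recursive (\<lambda>e. dropc (f e) (g e))" if "recursive f" "recursive g" for f g
    unfolding dropc_def
    by (intro recursive_rec_nat that recursive_psnd recursive_diff recursive_pfst recursive_id recursive_const)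
  have pfst_0: "pfst 0 = 0"
    using prod_encode_pfst_psnd[of 0] by (metis le_prod_encode_1 le_zero_eq)
  have hd: "pfst (list_encode xs - 1) = (if xs = [] then 0 else hd xs)" for xs
    by (cases xs) (auto simp: pfst_0)
  have at: "at c i = pfst (dropc c i - 1)" for c i
    unfolding dropc hd by (auto simp: at_def hd_drop_conv_nth)
  show "recursive f \<Longrightarrow> recursive g \<Longrightarrow> recursive (\<lambda>e. at (f e) (g e))"
    unfolding at by (intro recursive_pfst recursive_diff rd recursive_const)
  have drop0: "dropc c i = 0 \<longleftrightarrow> len c \<le> i" for c i
    unfolding dropc len_def by (metis drop_eq_Nil list_encode.simps(1) list_encode_eq)
  have "len = (\<lambda>c. LEAST i. dropc c i = 0)"
    unfolding drop0 by (intro ext Least_equality[symmetric]) auto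
  moreover have "recursive (\<lambda>c. LEAST i. dropc c i = 0)"
  proof (rule recursive_Least)
    show "\<exists>i. dropc c i = 0" for c unfolding drop0 by blast
  qed (intro decidable_eq_0 rd recursive_pfst recursive_psnd recursive_id)
  ultimately have "recursive len" by simp
  then show "recursive f \<Longrightarrow> recursive (\<lambda>e. len (f e))" by (rule recursive_compose)
qed

text \<open>This plays the role of Goedel's beta function: finitely many choices become one number,
  which gives bounded quantifiers over enumerable predicates and paths of steps a single
  witness.\<close>

lemma ex_at: "\<exists>c. \<forall>i<m. at c i = f i"
  by (rule exI[of _ "list_encode (map f [0..<m])"]) simp

lemma enumerable_ball:
  assumes "enumerable (\<lambda>e. P (pfst e) (psnd e))" "recursive b"
  shows "enumerable (\<lambda>e. \<forall>i<b e. P i e)"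
proof -
  obtain Q where Q: "decidable Q" "\<And>e. P (pfst e) (psnd e) \<longleftrightarrow> (\<exists>k. Q (prod_encode (k, e)))"
    using assms(1) unfolding enumerable_def by blast
  have P: "P i e \<longleftrightarrow> (\<exists>k. Q (prod_encode (k, prod_encode (i, e))))" for i e
    using Q(2)[of "prod_encode (i, e)"] by simp
  have "(\<forall>i<b e. P i e) \<longleftrightarrow> (\<exists>c. \<forall>i<b e. Q (prod_encode (at c i, prod_encode (i, e))))" for e
  proof
    assume "\<forall>i<b e. P i e"
    then obtain k where k: "\<And>i. i < b e \<Longrightarrow> Q (prod_encode (k i, prod_encode (i, e)))"
      unfolding P by metis
    obtain c where "\<forall>i<b e. at c i = k i" using ex_at by blast
    then show "\<exists>c. \<forall>i<b e. Q (prod_encode (at c i, prod_encode (i, e)))"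
      using k by (intro exI[of _ c]) simp
  qed (auto simp: P)
  moreover have "enumerable (\<lambda>e. \<exists>c. \<forall>i<b e. Q (prod_encode (at c i, prod_encode (i, e))))"
    by (intro enumerable_ex decidable_imp_enumerable decidable_ball decidable_compose[OF Q(1)]
      recursive_compose[OF assms(2)] recursive_at recursive_pair recursive_pfst recursive_psnd recursive_id)
  ultimately show ?thesis by simp
qed

lemma rtranclp_iff_at:
  "S\<^sup>*\<^sup>* x y \<longleftrightarrow> (\<exists>c m. at c 0 = x \<and> at c m = y \<and> (\<forall>i<m. S (at c i) (at c (Suc i))))"
proof
  assume "S\<^sup>*\<^sup>* x y"
  then obtain m where "(S ^^ m) x y" using rtranclp_imp_relpowp by metis
  then obtain f where f: "f 0 = x" "f m = y" "\<forall>i<m. S (f i) (f (Suc i))"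
    unfolding relpowp_fun_conv by blast
  obtain c where c: "\<forall>i<Suc m. at c i = f i" using ex_at by blast
  show "\<exists>c m. at c 0 = x \<and> at c m = y \<and> (\<forall>i<m. S (at c i) (at c (Suc i)))"
    by (rule exI[of _ c], rule exI[of _ m]) (use c f in simp)
next
  assume "\<exists>c m. at c 0 = x \<and> at c m = y \<and> (\<forall>i<m. S (at c i) (at c (Suc i)))"
  then show "S\<^sup>*\<^sup>* x y"
    by (metis relpowp_fun_conv relpowp_imp_rtranclp)
qed

lemma enumerable_rtranclp:
  assumes "enumerable (\<lambda>e. S (pfst e) (pfst (psnd e)) (psnd (psnd e)))" "recursive f" "recursive g"
  shows "enumerable (\<lambda>e. (\<lambda>x y. S x y e)\<^sup>*\<^sup>* (f e) (g e))"
proof -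
  have S: "enumerable (\<lambda>e. S (a e) (b e) (d e))" if "recursive a" "recursive b" "recursive d" for a b d
    using enumerable_compose[OF assms(1), of "\<lambda>e. prod_encode (a e, prod_encode (b e, d e))"] that
    by (simp add: recursive_pair)
  show ?thesis
    unfolding rtranclp_iff_at
    by (intro enumerable_ex enumerable_conj enumerable_ball S decidable_imp_enumerable decidable_eq
      recursive_compose[OF assms(2)] recursive_compose[OF assms(3)]
      recursive_at recursive_Suc recursive_pfst recursive_psnd recursive_id recursive_const)
qed

definition appendc :: "nat \<Rightarrow> nat \<Rightarrow> nat" where
  "appendc a b = list_encode (list_decode a @ list_decode b)"

lemma appendc_list_encode [simp]: "appendc (list_encode xs) (list_encode ys) = list_encode (xs @ ys)"
  by (simp add: appendc_def)

lemma recursive_appendc: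
  assumes "recursive f" "recursive g"
  shows "recursive (\<lambda>e. appendc (f e) (g e))"
proof -
  have *: "c = appendc a b \<longleftrightarrow> len c = len a + len b \<and> (\<forall>i<len a. at c i = at a i)
      \<and> (\<forall>i<len b. at c (len a + i) = at b i)" (is "_ \<longleftrightarrow> ?r") for a b c
  proof
    assume r: ?r
    have "list_decode c = list_decode a @ list_decode b"
    proof (rule nth_equalityI)
      fix i assume "i < length (list_decode c)"
      then show "list_decode c ! i = (list_decode a @ list_decode b) ! i"
        using r[THEN conjunct2, THEN conjunct2, rule_format, of "i - len a"] r
        by (cases "i < len a") (auto simp: len_def at_def nth_append)
    qed (use r in \<open>simp add: len_def\<close>)
    then show "c = appendc a b" by (metis appendc_def list_decode_inverse)
  qed (auto simp: appendc_def len_def at_def nth_append)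
  show ?thesis
    by (rule recursive_graph, unfold *)
      (intro decidable_conj decidable_eq decidable_ball recursive_add recursive_len recursive_at
        assms[THEN recursive_compose] recursive_pfst recursive_psnd recursive_id)
qed

text \<open>Post's theorem under a promise: one program searches for witnesses of both predicates at
  once. Nothing is claimed about inputs on which both or neither hold, so promised properties of the
  input need not be checked.\<close>

lemma computes_of_enumerable:
  assumes "enumerable P" "enumerable Q"
  shows "\<exists>p. \<forall>e. (P e \<longleftrightarrow> \<not> Q e) \<longrightarrow> computes p [e] (of_bool (P e))"
proof -
  obtain P' Q' where *: "decidable P'" "\<And>e. P e \<longleftrightarrow> (\<exists>k. P' (prod_encode (k, e)))"
    "decidable Q'" "\<And>e. Q e \<longleftrightarrow> (\<exists>k. Q' (prod_encode (k, e)))"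
    using assms unfolding enumerable_def by blast
  obtain p q pp where p: "\<And>e. computes p [e] (of_bool (P' e))"
    "\<And>e. computes q [e] (of_bool (\<not> (P' e \<or> Q' e)))"
    "\<And>x y. computes pp [x, y] (prod_encode (x, y))"
    using *(1) decidable_not[OF decidable_disj[OF *(1,3)]] recursive2_prod_encode
    unfolding decidable_def recursive_def recursive2_def by metis
  have "computes (Comp p [Comp pp [Mu (Comp q [pp]), Proj 0]]) [e] (of_bool (P e))" if PQ: "P e \<longleftrightarrow> \<not> Q e" for e
  proof -
    let ?ok = "\<lambda>k. P' (prod_encode (k, e)) \<or> Q' (prod_encode (k, e))"
    have ex: "\<exists>k. ?ok k" using PQ * by blast
    have "computes (Mu (Comp q [pp])) [e] (LEAST k. ?ok k)"
    proof (rule computes_Mu)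
      show "computes (Comp q [pp]) [k, e] (of_bool (\<not> ?ok k))" for k
        by (rule computes_Comp1[OF p(3) p(2)])
    qed (use LeastI_ex[OF ex] in \<open>auto dest: not_less_Least\<close>)
    moreover have "computes (Proj 0) [e] e" by (simp add: computes_Proj)
    ultimately have "computes (Comp p [Comp pp [Mu (Comp q [pp]), Proj 0]]) [e]
        (of_bool (P' (prod_encode (LEAST k. ?ok k, e))))"
      by (blast intro: computes_Comp1 computes_Comp2 p)
    \<comment> \<open>If \<open>Q\<close> holds then \<open>P\<close> does not, and
      \<open>P'\<close> fails at every witness; if \<open>P\<close> holds then only
      \<open>P'\<close> can have stopped the search.\<close>
    moreover have "P' (prod_encode (LEAST k. ?ok k, e)) \<longleftrightarrow> P e"
      using LeastI_ex[OF ex] PQ * by blast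
    ultimately show ?thesis by simp
  qed
  then show ?thesis by blast
qed

section \<open>Separation of twisted conjugacy classes\<close>

context group
begin

lemma inv_mult_cancel [simp]:
  assumes "x \<in> carrier G" "y \<in> carrier G"
  shows "inv x \<otimes> (x \<otimes> y) = y" "x \<otimes> (inv x \<otimes> y) = y"
  using assms by (simp_all flip: m_assoc)

lemma mult_inv_eq_one_iff:
  assumes "x \<in> carrier G" "y \<in> carrier G"
  shows "x \<otimes> inv y = \<one> \<longleftrightarrow> x = y"
  using assms by (metis inv_closed r_inv right_cancel)

abbreviation commutator :: "'a \<Rightarrow> 'a \<Rightarrow> 'a" where
  "commutator h g \<equiv> h \<otimes> g \<otimes> inv h \<otimes> inv g"

section \<open>Cosets, quotients and centrality modulo a subgroup\<close>

definition finite_index :: "'a set \<Rightarrow> bool" where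
  "finite_index N \<longleftrightarrow> finite ((#>) N ` carrier G)"

text \<open>For normal \<open>N\<close>, the preimage of the centre of \<open>G Mod N\<close>. In
  terms of commutators it is visibly monotone in \<open>N\<close> and available before
  \<open>N\<close> is known to be normal.\<close>

definition centralizer_mod :: "'a set \<Rightarrow> 'a set" where
  "centralizer_mod N = {x \<in> carrier G. \<forall>g\<in>carrier G. commutator x g \<in> N}"

lemma mem_rcos_iff:
  assumes "subgroup N G" "y \<in> carrier G"
  shows "x \<in> N #> y \<longleftrightarrow> x \<in> carrier G \<and> x \<otimes> inv y \<in> N"
proof
  assume "x \<in> N #> y"
  then show "x \<in> carrier G \<and> x \<otimes> inv y \<in> N"
    using assms by (auto simp: r_coset_def m_assoc subgroup.mem_carrier)
next
  assume x: "x \<in> carrier G \<and> x \<otimes> inv y \<in> N"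
  then have "x = (x \<otimes> inv y) \<otimes> y" using assms by (simp add: m_assoc)
  with x show "x \<in> N #> y" unfolding r_coset_def by blast
qed

lemma rcos_eq_iff:
  assumes "subgroup N G" "x \<in> carrier G" "y \<in> carrier G"
  shows "N #> x = N #> y \<longleftrightarrow> x \<otimes> inv y \<in> N"
  using mem_rcos_iff[OF assms(1,3), of x] rcos_self[OF assms(2,1)] repr_independence[OF _ assms(3,1), of x] assms(2)
  by blast

lemma rcos_mono:
  assumes "subgroup N G" "subgroup N' G" "N \<subseteq> N'" "x \<in> carrier G" "y \<in> carrier G" "N #> x = N #> y"
  shows "N' #> x = N' #> y"
  using assms by (auto simp: rcos_eq_iff)

text \<open>Working in a quotient group with an anonymous projection keeps the simplifier from
  unfolding the multiplication of cosets.\<close>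

lemma quotientE:
  assumes "N \<lhd> G"
  obtains Q :: "'a set monoid" and p where "group_hom G Q p"
    "\<forall>x\<in>carrier G. \<forall>y\<in>carrier G. N #> x = N #> y \<longleftrightarrow> p x = p y"
    "\<forall>x\<in>carrier G. x \<in> N \<longleftrightarrow> p x = \<one>\<^bsub>Q\<^esub>"
proof
  show h: "group_hom G (G Mod N) ((#>) N)"
    using assms normal.factorgroup_is_group normal.r_coset_hom_Mod
    by (metis group_axioms group_hom.intro group_hom_axioms.intro)
  show "\<forall>x\<in>carrier G. x \<in> N \<longleftrightarrow> N #> x = \<one>\<^bsub>G Mod N\<^esub>"
    using coset_join1 coset_join2 normal_imp_subgroup[OF assms] subgroup.subset by fastforce
qed simp

lemma commutator_mem_iff:
  assumes "group_hom G Q p" "\<forall>x\<in>carrier G. x \<in> N \<longleftrightarrow> p x = \<one>\<^bsub>Q\<^esub>" "x \<in> carrier G" "g \<in> carrier G"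
  shows "commutator x g \<in> N \<longleftrightarrow> p x \<otimes>\<^bsub>Q\<^esub> p g = p g \<otimes>\<^bsub>Q\<^esub> p x"
proof -
  interpret q: group_hom G Q p by fact
  have "commutator x g \<in> N \<longleftrightarrow> p x \<otimes>\<^bsub>Q\<^esub> p g \<otimes>\<^bsub>Q\<^esub> inv\<^bsub>Q\<^esub> (p g \<otimes>\<^bsub>Q\<^esub> p x) = \<one>\<^bsub>Q\<^esub>"
    using assms by (simp add: q.H.inv_mult_group q.H.m_assoc)
  also have "\<dots> \<longleftrightarrow> p x \<otimes>\<^bsub>Q\<^esub> p g = p g \<otimes>\<^bsub>Q\<^esub> p x"
    using assms(3,4) by (intro q.H.mult_inv_eq_one_iff) simp_all
  finally show ?thesis .
qed

lemma commute_subgroup: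
  assumes "group_hom G Q p" "q \<in> carrier Q"
  shows "subgroup {g \<in> carrier G. q \<otimes>\<^bsub>Q\<^esub> p g = p g \<otimes>\<^bsub>Q\<^esub> q} G"
proof -
  interpret q: group_hom G Q p by fact
  show ?thesis
  proof (rule subgroupI)
    fix a assume "a \<in> {g \<in> carrier G. q \<otimes>\<^bsub>Q\<^esub> p g = p g \<otimes>\<^bsub>Q\<^esub> q}"
    then show "inv a \<in> {g \<in> carrier G. q \<otimes>\<^bsub>Q\<^esub> p g = p g \<otimes>\<^bsub>Q\<^esub> q}"
      using assms(2) by simp (metis q.H.inv_solve_left q.H.inv_solve_right q.H.inv_closed q.H.m_assoc q.H.m_closed q.hom_closed)
  next
    fix a b assume "a \<in> {g \<in> carrier G. q \<otimes>\<^bsub>Q\<^esub> p g = p g \<otimes>\<^bsub>Q\<^esub> q}" "b \<in> {g \<in> carrier G. q \<otimes>\<^bsub>Q\<^esub> p g = p g \<otimes>\<^bsub>Q\<^esub> q}"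
    then show "a \<otimes> b \<in> {g \<in> carrier G. q \<otimes>\<^bsub>Q\<^esub> p g = p g \<otimes>\<^bsub>Q\<^esub> q}"
      using assms(2) by simp (metis q.H.m_assoc q.hom_closed)
  qed (use assms(2) in \<open>auto intro: exI[of _ \<one>]\<close>)
qed

lemma centralizer_mod_alt:
  assumes "group_hom G Q p" "\<forall>x\<in>carrier G. x \<in> N \<longleftrightarrow> p x = \<one>\<^bsub>Q\<^esub>"
  shows "centralizer_mod N = {x \<in> carrier G. \<forall>g\<in>carrier G. p x \<otimes>\<^bsub>Q\<^esub> p g = p g \<otimes>\<^bsub>Q\<^esub> p x}"
  using commutator_mem_iff[OF assms] by (auto simp: centralizer_mod_def)

lemma subgroup_centralizer_mod:
  assumes "N \<lhd> G"
  shows "subgroup (centralizer_mod N) G"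
proof -
  obtain Q :: "'a set monoid" and p where Q: "group_hom G Q p"
    "\<forall>x\<in>carrier G. \<forall>y\<in>carrier G. N #> x = N #> y \<longleftrightarrow> p x = p y"
    "\<forall>x\<in>carrier G. x \<in> N \<longleftrightarrow> p x = \<one>\<^bsub>Q\<^esub>"
    by (rule quotientE[OF assms])
  interpret q: group_hom G Q p by fact
  have "centralizer_mod N = (\<Inter>g\<in>carrier G. {x \<in> carrier G. p g \<otimes>\<^bsub>Q\<^esub> p x = p x \<otimes>\<^bsub>Q\<^esub> p g})"
    unfolding centralizer_mod_alt[OF Q(1,3)] by auto
  also have "subgroup \<dots> G"
    by (rule subgroups_Inter) (auto intro: commute_subgroup[OF Q(1)])
  finally show ?thesis .
qed

lemma normal_of_commutators:
  assumes "subgroup B G" "\<And>b g. b \<in> B \<Longrightarrow> g \<in> carrier G \<Longrightarrow> commutator b g \<in> B"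
  shows "B \<lhd> G"
proof (rule normal_invI[OF assms(1)])
  fix g b assume "g \<in> carrier G" "b \<in> B"
  moreover from this have "g \<otimes> b \<otimes> inv g = inv (commutator b g) \<otimes> b"
    using subgroup.mem_carrier[OF assms(1)] by (simp add: inv_mult_group m_assoc)
  ultimately show "g \<otimes> b \<otimes> inv g \<in> B"
    using assms by (simp add: subgroup.m_closed subgroup.m_inv_closed)
qed

lemma subset_centralizer_mod:
  assumes "N \<lhd> G"
  shows "N \<subseteq> centralizer_mod N"
proof
  interpret normal N G by fact
  fix x assume x: "x \<in> N"
  have "commutator x g \<in> N" if g: "g \<in> carrier G" for g
  proof -
    have "x \<otimes> (g \<otimes> inv x \<otimes> inv g) \<in> N" using x g by (simp add: inv_op_closed2)
    then show ?thesis using x g by (simp add: m_assoc mem_carrier)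
  qed
  then show "x \<in> centralizer_mod N" using x by (simp add: centralizer_mod_def mem_carrier)
qed

text \<open>Commutators of \<open>B\<close> with \<open>G\<close> already lie in \<open>N\<close>.
  The case \<open>B = N\<close> gives the normality of the lower term of a central step, the general
  case that of every subgroup in between.\<close>

lemma normal_between:
  assumes "subgroup B G" "N \<subseteq> B" "B \<subseteq> centralizer_mod N"
  shows "B \<lhd> G"
  using assms by (auto intro!: normal_of_commutators simp: centralizer_mod_def)

lemma generate_insert_normalE:
  assumes "N \<lhd> G" "y \<in> carrier G" "x \<in> generate G (insert y N)"
  obtains m and i :: int where "m \<in> N" "x = m \<otimes> y [^] i"
proof -
  interpret normal N G by fact
  from assms(3) have "\<exists>m\<in>N. \<exists>i::int. x = m \<otimes> y [^] i"
  proof induction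
    case one
    show ?case by (intro bexI[of _ \<one>] exI[of _ 0]) simp_all
  next
    case (incl h)
    then consider "h = y" | "h \<in> N" by blast
    then show ?case
    proof cases
      case 1
      then show ?thesis using assms(2) by (intro bexI[of _ \<one>] exI[of _ 1]) simp_all
    next
      case 2
      then show ?thesis by (intro bexI[of _ h] exI[of _ 0]) simp_all
    qed
  next
    case (inv h)
    then consider "h = y" | "h \<in> N" by blast
    then show ?case
    proof cases
      case 1
      then show ?thesis using assms(2) by (intro bexI[of _ \<one>] exI[of _ "-1"]) (simp_all add: int_pow_neg)
    next
      case 2
      then show ?thesis by (intro bexI[of _ "inv h"] exI[of _ 0]) simp_all
    qed
  next
    case (eng h k)
    then obtain m m' and i j :: int where mi: "m \<in> N" "h = m \<otimes> y [^] i" "m' \<in> N" "k = m' \<otimes> y [^] j" by blast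
    have "y [^] i \<otimes> m' \<otimes> inv (y [^] i) \<in> N" using assms(2) mi by (simp add: inv_op_closed2)
    moreover have "h \<otimes> k = (m \<otimes> (y [^] i \<otimes> m' \<otimes> inv (y [^] i))) \<otimes> y [^] (i + j)"
      using assms(2) mi by (simp add: m_assoc int_pow_mult mem_carrier)
    ultimately show ?case using mi by (metis m_closed)
  qed
  then show ?thesis using that by blast
qed

text \<open>The series is built downwards so that the induction hypothesis speaks of the larger
  term, that is, of a smaller quotient of \<open>G\<close>. Recording a term rather than the whole
  series keeps lengths and indices out of the inductions.\<close>

inductive central_cyclic_chain :: "'a set \<Rightarrow> bool" where
  top: "central_cyclic_chain (carrier G)"
| down: "\<lbrakk>central_cyclic_chain M'; subgroup M G; M' \<subseteq> centralizer_mod M; M' = generate G (insert y M)\<rbrakk>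
    \<Longrightarrow> central_cyclic_chain M"

lemma central_cyclic_chain_subgroup: "central_cyclic_chain M \<Longrightarrow> subgroup M G"
  by (induction rule: central_cyclic_chain.induct) (auto intro: subgroup_self)

lemma central_cyclic_chain_downD:
  assumes "subgroup M G" "M' \<subseteq> centralizer_mod M" "M' = generate G (insert y M)"
  shows "M \<subseteq> M'" "y \<in> M'" "y \<in> carrier G" "M \<lhd> G"
proof -
  show M: "M \<subseteq> M'" and y: "y \<in> M'" using assms(3) by (auto intro: generate.incl)
  show "y \<in> carrier G" using y assms(2) by (auto simp: centralizer_mod_def)
  show "M \<lhd> G" using assms(1,2) M by (auto intro!: normal_between)
qed

lemma central_cyclic_chain_normal: "central_cyclic_chain M \<Longrightarrow> M \<lhd> G"
  by (induction rule: central_cyclic_chain.induct) (auto intro: normal_self central_cyclic_chain_downD)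

section \<open>Residual finiteness\<close>

definition torsion_center_mod :: "'a set \<Rightarrow> bool" where
  "torsion_center_mod L \<longleftrightarrow> (\<forall>w\<in>centralizer_mod L. \<exists>k::nat>0. w [^] k \<in> L)"

text \<open>Let \<open>N\<close> be the number of cosets. Modulo \<open>L\<close>, the
  \<open>N + 1\<close> commutators of \<open>y^0, ..., y^N\<close> with \<open>g\<close> take at
  most \<open>N\<close> values, so two agree and \<open>y^d\<close> commutes with \<open>g\<close>
  for some positive \<open>d \<le> N\<close>. This \<open>d\<close> depends on \<open>g\<close>; the
  factorial is a multiple of all of them.\<close>

lemma pow_central_mod:
  assumes "L \<lhd> G" "finite ((#>) L ` M)" "y \<in> carrier G" "\<And>g e. g \<in> carrier G \<Longrightarrow> commutator (y [^] (e::nat)) g \<in> M"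
  shows "y [^] (fact (card ((#>) L ` M)) :: nat) \<in> centralizer_mod L"
proof -
  obtain Q :: "'a set monoid" and p where Q: "group_hom G Q p"
    "\<forall>x\<in>carrier G. \<forall>y\<in>carrier G. L #> x = L #> y \<longleftrightarrow> p x = p y"
    "\<forall>x\<in>carrier G. x \<in> L \<longleftrightarrow> p x = \<one>\<^bsub>Q\<^esub>"
    by (rule quotientE[OF assms(1)])
  interpret q: group_hom G Q p by fact
  let ?N = "card ((#>) L ` M)"
  have "p (y [^] (fact ?N :: nat)) \<otimes>\<^bsub>Q\<^esub> p g = p g \<otimes>\<^bsub>Q\<^esub> p (y [^] (fact ?N :: nat))" if g: "g \<in> carrier G" for g
  proof -
    let ?f = "\<lambda>e::nat. L #> commutator (y [^] e) g"
    have "card (?f ` {..?N}) \<le> ?N"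
      by (rule card_mono[OF assms(2)]) (use assms(4) g in auto)
    then have "\<not> inj_on ?f {..?N}" by (intro pigeonhole) simp
    then obtain e f where ef: "e < f" "f \<le> ?N" "?f e = ?f f"
      by (auto simp: inj_on_def) (metis linorder_neqE_nat)
    define d where "d = f - e"
    have d: "0 < d" "d \<le> ?N" "f = e + d" using ef by (auto simp: d_def)
    have "p (commutator (y [^] e) g) = p (commutator (y [^] f) g)"
      using ef(3) assms(3) g by (simp add: Q(2))
    moreover have "y [^] f = y [^] e \<otimes> y [^] d" using assms(3) d by (simp add: nat_pow_mult)
    ultimately have "p g \<otimes>\<^bsub>Q\<^esub> (inv\<^bsub>Q\<^esub> p (y [^] e) \<otimes>\<^bsub>Q\<^esub> inv\<^bsub>Q\<^esub> p g) =
        p (y [^] d) \<otimes>\<^bsub>Q\<^esub> (p g \<otimes>\<^bsub>Q\<^esub> (inv\<^bsub>Q\<^esub> p (y [^] d) \<otimes>\<^bsub>Q\<^esub> (inv\<^bsub>Q\<^esub> p (y [^] e) \<otimes>\<^bsub>Q\<^esub> inv\<^bsub>Q\<^esub> p g)))"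
      using assms(3) g by (simp add: q.H.inv_mult_group q.H.m_assoc)
    then have "p g = p (y [^] d) \<otimes>\<^bsub>Q\<^esub> p g \<otimes>\<^bsub>Q\<^esub> inv\<^bsub>Q\<^esub> p (y [^] d)"
      using assms(3) g by (simp flip: q.H.m_assoc)
    then have "p g \<otimes>\<^bsub>Q\<^esub> p (y [^] d) = p (y [^] d) \<otimes>\<^bsub>Q\<^esub> p g"
      using assms(3) g by (metis q.H.inv_solve_right q.H.m_closed q.hom_closed nat_pow_closed)
    moreover obtain j where "fact ?N = d * j" using d dvd_fact[of d ?N] by (auto simp: dvd_def)
    ultimately show ?thesis
      using assms(3) g q.H.group_commutes_pow[of "p (y [^] d)" "p g" j]
      by (simp add: q.hom_nat_pow q.H.nat_pow_pow)
  qed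
  then show ?thesis using centralizer_mod_alt[OF Q(1,3)] assms(3) by simp
qed

text \<open>Modulo \<open>L\<close> the exponents of \<open>y\<close> matter only modulo
  \<open>k\<close>, so each coset is the product of one of finitely many cosets from
  \<open>M\<close> and one of \<open>k\<close> powers.\<close>

lemma finite_cosets_generate_insert:
  assumes "L \<lhd> G" "M \<lhd> G" "finite ((#>) L ` M)" "y \<in> carrier G" "y [^] (k::nat) \<in> L" "k > 0"
  shows "finite ((#>) L ` generate G (insert y M))"
proof -
  obtain Q :: "'a set monoid" and p where Q: "group_hom G Q p"
    "\<forall>x\<in>carrier G. \<forall>y\<in>carrier G. L #> x = L #> y \<longleftrightarrow> p x = p y"
    "\<forall>x\<in>carrier G. x \<in> L \<longleftrightarrow> p x = \<one>\<^bsub>Q\<^esub>"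
    by (rule quotientE[OF assms(1)])
  interpret q: group_hom G Q p by fact
  interpret L: normal L G by fact
  interpret M: normal M G by fact
  have "(#>) L ` generate G (insert y M) \<subseteq> (\<lambda>(A, i). A <#> (L #> y [^] i)) ` (((#>) L ` M) \<times> {0..<int k})"
  proof (rule image_subsetI)
    fix x assume "x \<in> generate G (insert y M)"
    then obtain m and i :: int where mi: "m \<in> M" "x = m \<otimes> y [^] i"
      using generate_insert_normalE assms(2,4) by blast
    have "p (y [^] k) = \<one>\<^bsub>Q\<^esub>" using Q(3) assms(4,5) by simp
    then have "p (y [^] (int k * (i div int k))) = \<one>\<^bsub>Q\<^esub>"
      using assms(4) by (simp add: int_pow_pow[symmetric] int_pow_int q.hom_int_pow)
    then have "p (y [^] i) = p (y [^] (i mod int k))"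
      using assms(4) int_pow_mult[OF assms(4), of "int k * (i div int k)" "i mod int k"] by simp
    then have "p x = p (m \<otimes> y [^] (i mod int k))" using mi assms(4) by simp
    then have "L #> x = L #> (m \<otimes> y [^] (i mod int k))" using mi assms(4) by (simp add: Q(2))
    then have "L #> x = (L #> m) <#> (L #> y [^] (i mod int k))"
      using mi assms(4) by (simp add: L.rcos_sum)
    moreover have "i mod int k \<in> {0..<int k}" using assms(6) by simp
    ultimately show "L #> x \<in> (\<lambda>(A, i). A <#> (L #> y [^] i)) ` (((#>) L ` M) \<times> {0..<int k})"
      using mi(1) by force
  qed
  then show ?thesis by (rule finite_subset) (use assms(3) in simp)
qed

text \<open>Finiteness modulo \<open>L\<close> climbs the series: some power of the next generator
  \<open>y\<close> is central modulo \<open>L\<close>, a further power lies in \<open>L\<close> by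
  torsion, and so \<open>M'\<close> is finite modulo \<open>L\<close> as well.\<close>

lemma finite_index_of_torsion_center_mod:
  assumes "central_cyclic_chain M" "L \<lhd> G" "finite ((#>) L ` M)" "torsion_center_mod L"
  shows "finite_index L"
  using assms(1,3)
proof (induction rule: central_cyclic_chain.induct)
  case top
  then show ?case by (simp add: finite_index_def)
next
  case (down M' M y)
  note D = central_cyclic_chain_downD[OF down.hyps(2,3,4)]
  have "commutator (y [^] (e::nat)) g \<in> M" if "g \<in> carrier G" for g e
  proof -
    have "y [^] e \<in> centralizer_mod M"
      using subgroup_centralizer_mod[OF D(4)] D(2) down.hyps(3)
      by (induction e) (auto intro: subgroup.m_closed subgroup.one_closed)
    then show ?thesis using that by (simp add: centralizer_mod_def)
  qed
  then have "y [^] (fact (card ((#>) L ` M)) :: nat) \<in> centralizer_mod L"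
    using pow_central_mod[OF assms(2) down.prems D(3)] by blast
  then obtain k where k: "k > 0" "(y [^] (fact (card ((#>) L ` M)) :: nat)) [^] (k::nat) \<in> L"
    using assms(4) unfolding torsion_center_mod_def by blast
  then have "y [^] (fact (card ((#>) L ` M)) * k) \<in> L" using D(3) by (simp add: nat_pow_pow)
  moreover have "fact (card ((#>) L ` M)) * k > 0" using k by simp
  ultimately have "finite ((#>) L ` M')"
    using finite_cosets_generate_insert[OF assms(2) D(4) down.prems D(3)] down.hyps(4) by blast
  then show ?case by (rule down.IH)
qed

lemma normal_Union_chain:
  assumes "C \<noteq> {}" "subset.chain {N. N \<lhd> G} C"
  shows "\<Union>C \<lhd> G"
proof (rule normal_invI)
  have C: "\<And>N. N \<in> C \<Longrightarrow> N \<lhd> G" and ch: "\<And>N N'. N \<in> C \<Longrightarrow> N' \<in> C \<Longrightarrow> N \<subseteq> N' \<or> N' \<subseteq> N"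
    using assms(2) by (auto simp: subset_chain_def)
  note S = C[THEN normal_imp_subgroup]
  show "subgroup (\<Union>C) G"
  proof (rule subgroupI)
    show "\<Union>C \<subseteq> carrier G" using S[THEN subgroup.subset] by (rule Union_least)
    show "\<Union>C \<noteq> {}" using assms(1) S[THEN subgroup.one_closed] by (metis Union_iff all_not_in_conv)
    show "inv a \<in> \<Union>C" if "a \<in> \<Union>C" for a
      using that S[THEN subgroup.m_inv_closed] by (metis Union_iff)
    show "a \<otimes> b \<in> \<Union>C" if ab: "a \<in> \<Union>C" "b \<in> \<Union>C" for a b
    proof -
      from ab obtain N N' where N: "a \<in> N" "N \<in> C" "b \<in> N'" "N' \<in> C" by blast
      from ch[OF N(2,4)] show ?thesis
        using subgroup.m_closed[OF S[OF N(2)]] subgroup.m_closed[OF S[OF N(4)]] N by (metis Union_iff subsetD)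
    qed
  qed
  show "x \<otimes> h \<otimes> inv x \<in> \<Union>C" if "x \<in> carrier G" "h \<in> \<Union>C" for x h
    using that normal.inv_op_closed2[OF C] by (metis Union_iff)
qed

text \<open>A normal subgroup \<open>L\<close> that is maximal with respect to omitting \<open>z\<close> has finite index: if \<open>w\<close> is
  central modulo \<open>L\<close> then \<open>z\<close> is a power \<open>w\<^sup>i\<close> modulo \<open>L\<close>, and as \<open>w\<^sup>2\<^sup>i\<close>, unless it lies in \<open>L\<close>,
  generates \<open>z\<close> modulo \<open>L\<close> as well, \<open>w\<close> is torsion modulo \<open>L\<close>.\<close>

lemma finite_index_separation:
  assumes "central_cyclic_chain M" "A \<lhd> G" "M \<subseteq> A" "z \<in> carrier G" "z \<notin> A"
  obtains L where "L \<lhd> G" "A \<subseteq> L" "z \<notin> L" "finite_index L"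
proof -
  let ?S = "{L. L \<lhd> G \<and> A \<subseteq> L \<and> z \<notin> L}"
  have "\<exists>L\<in>?S. \<forall>X\<in>?S. L \<subseteq> X \<longrightarrow> X = L"
  proof (rule subset_Zorn_nonempty)
    show "?S \<noteq> {}" using assms by blast
    fix C assume "C \<noteq> {}" "subset.chain ?S C"
    then show "\<Union>C \<in> ?S"
      using normal_Union_chain[of C] by (auto simp: subset_chain_def)
  qed
  then obtain L where L': "L \<in> ?S" and max': "\<forall>X\<in>?S. L \<subseteq> X \<longrightarrow> X = L" ..
  have L: "L \<lhd> G" "A \<subseteq> L" "z \<notin> L" using L' by simp_all
  have max: "X = L" if "X \<lhd> G" "L \<subseteq> X" "z \<notin> X" for X
    using max' that L(2) by simp
  obtain Q :: "'a set monoid" and p where Q: "group_hom G Q p"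
    "\<forall>x\<in>carrier G. \<forall>y\<in>carrier G. L #> x = L #> y \<longleftrightarrow> p x = p y"
    "\<forall>x\<in>carrier G. x \<in> L \<longleftrightarrow> p x = \<one>\<^bsub>Q\<^esub>"
    by (rule quotientE[OF L(1)])
  interpret q: group_hom G Q p by fact
  \<comment> \<open>Adjoining an element that is central modulo \<open>L\<close> keeps the subgroup
    normal, so by maximality the result is \<open>L\<close> itself or contains
    \<open>z\<close>.\<close>
  have gen: "y \<in> L \<or> (\<exists>i::int. p z = p y [^]\<^bsub>Q\<^esub> i)" if y: "y \<in> centralizer_mod L" for y
  proof (cases "z \<in> generate G (insert y L)")
    case True
    have yc: "y \<in> carrier G" using y by (simp add: centralizer_mod_def)
    obtain m and i :: int where "m \<in> L" "z = m \<otimes> y [^] i"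
      using generate_insert_normalE[OF L(1) yc True] by blast
    moreover from this have "m \<in> carrier G" using subgroup.mem_carrier[OF normal_imp_subgroup[OF L(1)]] by blast
    ultimately have "p z = p y [^]\<^bsub>Q\<^esub> i"
      using yc Q(3) by (simp add: q.hom_int_pow)
    then show ?thesis by blast
  next
    case False
    have sub: "insert y L \<subseteq> centralizer_mod L" using y subset_centralizer_mod[OF L(1)] by blast
    then have "insert y L \<subseteq> carrier G" by (auto simp: centralizer_mod_def)
    then have "generate G (insert y L) \<lhd> G"
      by (intro normal_between[of _ L] generate_is_subgroup generate_subgroup_incl sub
          subgroup_centralizer_mod L(1)) (auto intro: generate.incl)
    then have "generate G (insert y L) = L" by (rule max) (use False in \<open>auto intro: generate.incl\<close>)
    then show ?thesis using generate.incl[of y "insert y L" G] by auto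
  qed
  have "torsion_center_mod L"
    unfolding torsion_center_mod_def
  proof
    fix w assume w: "w \<in> centralizer_mod L"
    then have wc: "w \<in> carrier G" by (simp add: centralizer_mod_def)
    have tors: "\<exists>k::nat>0. w [^] k \<in> L" if "p w [^]\<^bsub>Q\<^esub> (i::int) = \<one>\<^bsub>Q\<^esub>" "i \<noteq> 0" for i
    proof -
      have "p w [^]\<^bsub>Q\<^esub> \<bar>i\<bar> = \<one>\<^bsub>Q\<^esub>"
        using that wc by (cases "i \<ge> 0") (simp_all add: q.H.int_pow_neg)
      then have "w [^] nat \<bar>i\<bar> \<in> L" using wc by (simp add: Q(3) q.hom_int_pow)
      then show ?thesis using that(2) by (intro exI[of _ "nat \<bar>i\<bar>"]) simp
    qed
    show "\<exists>k::nat>0. w [^] k \<in> L"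
    proof (cases "w \<in> L")
      case True
      then show ?thesis using wc by (intro exI[of _ 1]) simp
    next
      case False
      then obtain i :: int where i: "p z = p w [^]\<^bsub>Q\<^esub> i" using gen[OF w] by blast
      have "p z \<noteq> \<one>\<^bsub>Q\<^esub>" using L(3) assms(4) Q(3) by blast
      then have i0: "i \<noteq> 0" using i int_pow_0 by metis
      \<comment> \<open>The factor 2 guards against a void relation: \<open>w^i = w^(2ij)\<close>
        modulo \<open>L\<close> has exponent difference \<open>i (1 - 2j)\<close>, and
        \<open>1 - 2j\<close> is odd, hence nonzero.\<close>
      let ?y = "w [^] (2 * i)"
      have "?y \<in> centralizer_mod L"
        using w subgroup_int_pow_closed[OF subgroup_centralizer_mod[OF L(1)]] by blast
      then consider "?y \<in> L" | j :: int where "p z = p ?y [^]\<^bsub>Q\<^esub> j" using gen by blast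
      then show ?thesis
      proof cases
        case 1
        then have "p w [^]\<^bsub>Q\<^esub> (2 * i) = \<one>\<^bsub>Q\<^esub>" using wc by (simp add: Q(3) q.hom_int_pow)
        then show ?thesis by (rule tors) (use i0 in simp)
      next
        case (2 j)
        then have "p w [^]\<^bsub>Q\<^esub> i = p w [^]\<^bsub>Q\<^esub> (2 * i * j)"
          using wc i by (simp add: q.hom_int_pow q.H.int_pow_pow)
        then have "p w [^]\<^bsub>Q\<^esub> (i - 2 * i * j) = \<one>\<^bsub>Q\<^esub>"
          using wc by (simp add: q.H.int_pow_diff)
        moreover have "i - 2 * i * j = i * (1 - 2 * j)" by (simp add: algebra_simps)
        then have "i - 2 * i * j \<noteq> 0" using i0 by (auto, presburger)
        ultimately show ?thesis by (rule tors)
      qed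
    qed
  qed
  moreover have "(#>) L ` M \<subseteq> {L}"
  proof (rule image_subsetI)
    fix x assume "x \<in> M"
    then have "x \<in> L" using assms(3) L(2) by blast
    then show "L #> x \<in> {L}"
      using normal_imp_subgroup[OF L(1)] by (simp add: coset_join2 subgroup.mem_carrier)
  qed
  then have "finite ((#>) L ` M)" by (rule finite_subset) simp
  ultimately have "finite_index L" using finite_index_of_torsion_center_mod assms(1) L(1) by blast
  with L show ?thesis using that by blast
qed

section \<open>Separability of twisted conjugacy in finite quotients\<close>

lemma finite_index_Inter:
  assumes "finite F" "F \<noteq> {}" "\<And>N. N \<in> F \<Longrightarrow> N \<lhd> G \<and> finite_index N"
  shows "\<Inter>F \<lhd> G \<and> finite_index (\<Inter>F)"
  using assms
proof (induction F rule: finite_ne_induct)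
  case (singleton N)
  then show ?case by simp
next
  case (insert N F)
  have N: "N \<lhd> G" "finite_index N" and F: "\<Inter>F \<lhd> G" "finite_index (\<Inter>F)" using insert by auto
  note S = N(1)[THEN normal_imp_subgroup] F(1)[THEN normal_imp_subgroup]
  have "(#>) (N \<inter> \<Inter>F) ` carrier G \<subseteq> (\<lambda>(A, B). A \<inter> B) ` (((#>) N ` carrier G) \<times> ((#>) (\<Inter>F) ` carrier G))"
  proof (rule image_subsetI)
    fix x assume x: "x \<in> carrier G"
    have "(N \<inter> \<Inter>F) #> x = (N #> x) \<inter> (\<Inter>F #> x)"
      using x S normal_imp_subgroup[OF normal_subgroup_intersect[OF N(1) F(1)]] by (auto simp: mem_rcos_iff)
    then show "(N \<inter> \<Inter>F) #> x \<in> (\<lambda>(A, B). A \<inter> B) ` (((#>) N ` carrier G) \<times> ((#>) (\<Inter>F) ` carrier G))"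
      using x by (intro image_eqI[where x = "(N #> x, \<Inter>F #> x)"]) auto
  qed
  then have "finite_index (N \<inter> \<Inter>F)"
    unfolding finite_index_def by (rule finite_subset) (use N(2) F(2) in \<open>simp add: finite_index_def\<close>)
  then show ?case using normal_subgroup_intersect[OF N(1) F(1)] by simp
qed

text \<open>Translating the variable by \<open>x\<close> replaces \<open>w\<close> by
  \<open>(x\<phi>)\<^sup>-\<^sup>1 w (x\<psi>)\<close>. This moves a known solution modulo a larger
  term to the unit, and turns a question about a coset of \<open>C\<close> into one about
  \<open>C\<close>.\<close>

lemma rcos_twist_shift:
  assumes "N \<lhd> G" "group_hom D G \<phi>" "group_hom D G \<psi>" "x \<in> carrier D" "y \<in> carrier D" "w \<in> carrier G"
  shows "N #> \<phi> (x \<otimes>\<^bsub>D\<^esub> y) = N #> (w \<otimes> \<psi> (x \<otimes>\<^bsub>D\<^esub> y))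
    \<longleftrightarrow> N #> \<phi> y = N #> (inv (\<phi> x) \<otimes> w \<otimes> \<psi> x \<otimes> \<psi> y)"
proof -
  obtain Q :: "'a set monoid" and p where Q: "group_hom G Q p"
    "\<forall>x\<in>carrier G. \<forall>y\<in>carrier G. N #> x = N #> y \<longleftrightarrow> p x = p y"
    "\<forall>x\<in>carrier G. x \<in> N \<longleftrightarrow> p x = \<one>\<^bsub>Q\<^esub>"
    by (rule quotientE[OF assms(1)])
  interpret q: group_hom G Q p by fact
  interpret f: group_hom D G \<phi> by fact
  interpret g: group_hom D G \<psi> by fact
  have "p (\<phi> x) \<otimes>\<^bsub>Q\<^esub> p (\<phi> y) = p w \<otimes>\<^bsub>Q\<^esub> (p (\<psi> x) \<otimes>\<^bsub>Q\<^esub> p (\<psi> y))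
      \<longleftrightarrow> p (\<phi> y) = inv\<^bsub>Q\<^esub> p (\<phi> x) \<otimes>\<^bsub>Q\<^esub> (p w \<otimes>\<^bsub>Q\<^esub> (p (\<psi> x) \<otimes>\<^bsub>Q\<^esub> p (\<psi> y)))"
    using assms(4-6) q.H.inv_solve_left[of "p (\<phi> y)" "p (\<phi> x)" "p w \<otimes>\<^bsub>Q\<^esub> (p (\<psi> x) \<otimes>\<^bsub>Q\<^esub> p (\<psi> y))"]
    by auto
  then show ?thesis using assms(4-6) by (simp add: Q(2) q.H.m_assoc)
qed

text \<open>In the inductive step, \<open>z\<close> is central modulo \<open>M\<close> and the \<open>a \<in> M'\<close> with \<open>\<phi> x \<equiv> a \<psi> x mod M\<close> for some
  \<open>x \<in> K\<close>, necessarily with \<open>\<phi> x \<equiv> \<psi> x mod M'\<close>, form a normal subgroup \<open>A\<close> omitting \<open>z\<close>. A normal subgroup \<open>L \<supseteq> A\<close> of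
  finite index omitting \<open>z\<close> exists, but it need not separate, since \<open>\<phi> x \<equiv> z \<psi> x mod L\<close> does not
  entail \<open>\<phi> x \<equiv> \<psi> x mod M'\<close>. The induction hypothesis is therefore applied once more, to
  those of the finitely many cosets of \<open>C\<close>, on which both maps are trivial modulo \<open>L\<close>, that contain
  no \<open>x\<close> with \<open>\<phi> x \<equiv> \<psi> x mod M'\<close>.\<close>

theorem twisted_conjugacy_separable:
  assumes "central_cyclic_chain M" and f: "group_hom D G \<phi>" and g: "group_hom D G \<psi>"
  shows "\<lbrakk>subgroup K D; w \<in> carrier G; \<forall>x\<in>K. M #> \<phi> x \<noteq> M #> (w \<otimes> \<psi> x)\<rbrakk>
    \<Longrightarrow> \<exists>N. N \<lhd> G \<and> finite_index N \<and> M \<subseteq> N \<and> (\<forall>x\<in>K. N #> \<phi> x \<noteq> N #> (w \<otimes> \<psi> x))"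
  using assms(1)
proof (induction arbitrary: K w rule: central_cyclic_chain.induct)
  case top
  interpret f: group_hom D G \<phi> by fact
  interpret g: group_hom D G \<psi> by fact
  \<comment> \<open>All cosets of \<open>carrier G\<close> coincide, so the unit of \<open>K\<close>
    refutes the premise.\<close>
  have "\<one>\<^bsub>D\<^esub> \<in> K" using top(1) by (rule subgroup.one_closed)
  with top(3) have "carrier G #> \<phi> \<one>\<^bsub>D\<^esub> \<noteq> carrier G #> (w \<otimes> \<psi> \<one>\<^bsub>D\<^esub>)" by blast
  then show ?case using top(2) coset_join2[OF top(2) subgroup_self top(2)] by simp
next
  case (down M' M y)
  interpret f: group_hom D G \<phi> by fact
  interpret g: group_hom D G \<psi> by fact
  note D = central_cyclic_chain_downD[OF down.hyps(2,3,4)]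
  have nM': "M' \<lhd> G" by (rule central_cyclic_chain_normal) fact
  have cM: "central_cyclic_chain M" by (rule central_cyclic_chain.down) fact+
  have sM: "subgroup M G" and sM': "subgroup M' G" using D(4) nM' by (simp_all add: normal_imp_subgroup)
  have KD: "x \<in> carrier D" if "x \<in> K" for x using that down.prems(1) by (rule subgroup.mem_carrier[rotated])
  show ?case
  proof (cases "\<forall>x\<in>K. M' #> \<phi> x \<noteq> M' #> (w \<otimes> \<psi> x)")
    case True
    then show ?thesis using down.IH[OF down.prems(1,2)] D(1) by blast
  next
    case False
    then obtain x0 where x0: "x0 \<in> K" "M' #> \<phi> x0 = M' #> (w \<otimes> \<psi> x0)" by blast
    \<comment> \<open>\<open>x0\<close> solves the equation modulo \<open>M'\<close>. After
      translation by it the unit is a solution, which puts the new constant \<open>z\<close> into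
      \<open>M'\<close>, whose elements are central modulo \<open>M\<close>.\<close>
    define z where "z = inv (\<phi> x0) \<otimes> w \<otimes> \<psi> x0"
    have zc: "z \<in> carrier G" using x0(1) KD down.prems(2) by (simp add: z_def)
    have shift: "N #> \<phi> (x0 \<otimes>\<^bsub>D\<^esub> x) = N #> (w \<otimes> \<psi> (x0 \<otimes>\<^bsub>D\<^esub> x)) \<longleftrightarrow> N #> \<phi> x = N #> (z \<otimes> \<psi> x)"
      if "N \<lhd> G" "x \<in> K" for N x
      unfolding z_def using that by (intro rcos_twist_shift f g KD x0 down.prems(2))
    have "M' #> \<one> = M' #> z"
      using shift[OF nM', of "\<one>\<^bsub>D\<^esub>"] x0 KD zc subgroup.one_closed[OF down.prems(1)] by simp
    then have "z \<in> M'" using zc sM' by (metis coset_mult_one rcos_self subgroup.subset)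
    have zM: "M #> \<phi> x \<noteq> M #> (z \<otimes> \<psi> x)" if "x \<in> K" for x
      using down.prems(3) shift[OF D(4) that] subgroup.m_closed[OF down.prems(1) x0(1) that] by blast
    define A where "A = {a \<in> M'. \<exists>x\<in>K. M #> \<phi> x = M #> (a \<otimes> \<psi> x)}"
    have "z \<notin> A" using zM by (auto simp: A_def)
    have "M \<subseteq> A"
    proof
      fix a assume "a \<in> M"
      moreover from this have "M #> \<one> = M #> (a \<otimes> \<one>)"
        using sM by (metis coset_join2 one_closed r_one subgroup.mem_carrier subgroup.one_closed)
      ultimately show "a \<in> A"
        using D(1) subgroup.one_closed[OF down.prems(1)] by (auto simp: A_def intro!: bexI[of _ "\<one>\<^bsub>D\<^esub>"])
    qed
    \<comment> \<open>Elements of \<open>M'\<close> move past \<open>\<psi> x\<close> modulo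
      \<open>M\<close>, so the product of witnesses for \<open>a\<close> and \<open>b\<close> is a
      witness for \<open>a \<otimes> b\<close>.\<close>
    have "subgroup A G"
    proof -
      obtain Q :: "'a set monoid" and p where Q: "group_hom G Q p"
        "\<forall>x\<in>carrier G. \<forall>y\<in>carrier G. M #> x = M #> y \<longleftrightarrow> p x = p y"
        "\<forall>x\<in>carrier G. x \<in> M \<longleftrightarrow> p x = \<one>\<^bsub>Q\<^esub>"
        by (rule quotientE[OF D(4)])
      interpret q: group_hom G Q p by fact
      have central: "a \<in> carrier G \<and> (\<forall>g\<in>carrier G. p a \<otimes>\<^bsub>Q\<^esub> p g = p g \<otimes>\<^bsub>Q\<^esub> p a)" if "a \<in> M'" for a
        using down.hyps(3) that centralizer_mod_alt[OF Q(1,3)] by blast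
      have A: "a \<in> A \<longleftrightarrow> a \<in> M' \<and> (\<exists>x\<in>K. p (\<phi> x) = p a \<otimes>\<^bsub>Q\<^esub> p (\<psi> x))" for a
      proof -
        have "M #> \<phi> x = M #> (a \<otimes> \<psi> x) \<longleftrightarrow> p (\<phi> x) = p a \<otimes>\<^bsub>Q\<^esub> p (\<psi> x)" if "a \<in> M'" "x \<in> K" for x
          using central[OF that(1)] KD[OF that(2)] by (simp add: Q(2))
        then show ?thesis unfolding A_def by blast
      qed
      show ?thesis
      proof (rule subgroupI)
        show "A \<subseteq> carrier G" using subgroup.subset[OF sM'] by (auto simp: A_def)
        show "A \<noteq> {}" using \<open>M \<subseteq> A\<close> subgroup.one_closed[OF sM] by blast
        fix a assume a: "a \<in> A"
        then obtain x where x: "x \<in> K" "p (\<phi> x) = p a \<otimes>\<^bsub>Q\<^esub> p (\<psi> x)" and aM: "a \<in> M'" by (auto simp: A)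
        note ac = central[OF aM]
        have "inv\<^bsub>Q\<^esub> p (\<phi> x) = inv\<^bsub>Q\<^esub> (p (\<psi> x) \<otimes>\<^bsub>Q\<^esub> p a)" using x ac KD by simp
        also have "\<dots> = inv\<^bsub>Q\<^esub> p a \<otimes>\<^bsub>Q\<^esub> inv\<^bsub>Q\<^esub> p (\<psi> x)" using x ac KD by (simp add: q.H.inv_mult_group)
        finally have "p (\<phi> (inv\<^bsub>D\<^esub> x)) = p (inv a) \<otimes>\<^bsub>Q\<^esub> p (\<psi> (inv\<^bsub>D\<^esub> x))" using x ac KD by simp
        then show "inv a \<in> A"
          using subgroup.m_inv_closed[OF sM' aM] subgroup.m_inv_closed[OF down.prems(1) x(1)] by (auto simp: A)
        fix b assume b: "b \<in> A"
        then obtain x' where x': "x' \<in> K" "p (\<phi> x') = p b \<otimes>\<^bsub>Q\<^esub> p (\<psi> x')" and bM: "b \<in> M'" by (auto simp: A)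
        note bc = central[OF bM]
        have "p (\<phi> (x \<otimes>\<^bsub>D\<^esub> x')) = p a \<otimes>\<^bsub>Q\<^esub> (p (\<psi> x) \<otimes>\<^bsub>Q\<^esub> p b) \<otimes>\<^bsub>Q\<^esub> p (\<psi> x')"
          using x x' conjunct1[OF ac] conjunct1[OF bc] KD by (simp add: q.H.m_assoc)
        also have "p (\<psi> x) \<otimes>\<^bsub>Q\<^esub> p b = p b \<otimes>\<^bsub>Q\<^esub> p (\<psi> x)" using bc x KD by simp
        finally have "p (\<phi> (x \<otimes>\<^bsub>D\<^esub> x')) = p (a \<otimes> b) \<otimes>\<^bsub>Q\<^esub> p (\<psi> (x \<otimes>\<^bsub>D\<^esub> x'))"
          using x x' conjunct1[OF ac] conjunct1[OF bc] KD by (simp add: q.H.m_assoc)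
        then show "a \<otimes> b \<in> A"
          using subgroup.m_closed[OF sM' aM bM] subgroup.m_closed[OF down.prems(1) x(1) x'(1)] by (auto simp: A)
      qed
    qed
    then have "A \<lhd> G"
      using \<open>M \<subseteq> A\<close> down.hyps(3) by (intro normal_between) (auto simp: A_def)
    then obtain L where L: "L \<lhd> G" "A \<subseteq> L" "z \<notin> L" "finite_index L"
      using finite_index_separation[OF cM _ \<open>M \<subseteq> A\<close> zc \<open>z \<notin> A\<close>] by blast
    have sL: "subgroup L G" using L(1) by (rule normal_imp_subgroup)
    define C where "C = {x \<in> K. \<phi> x \<in> L \<and> \<psi> x \<in> L}"
    have sC: "subgroup C D"
    proof (rule f.subgroupI)
      show "C \<subseteq> carrier D" using KD by (auto simp: C_def)
      have "\<one>\<^bsub>D\<^esub> \<in> C" using subgroup.one_closed[OF down.prems(1)] subgroup.one_closed[OF sL] by (simp add: C_def)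
      then show "C \<noteq> {}" by blast
    qed (use KD in \<open>auto simp: C_def intro: subgroup.m_closed[OF down.prems(1)] subgroup.m_inv_closed[OF down.prems(1)]
      subgroup.m_closed[OF sL] subgroup.m_inv_closed[OF sL]\<close>)
    \<comment> \<open>The inverses fit right cosets of \<open>L\<close> to left cosets of
      \<open>C\<close>: for \<open>t\<close> and \<open>x\<close> in \<open>K\<close>,
      \<open>\<rho> t = \<rho> x\<close> says that \<open>t\<^sup>-\<^sup>1 x\<close> lies in
      \<open>C\<close>.\<close>
    define \<rho> where "\<rho> x = (L #> inv (\<phi> x), L #> inv (\<psi> x))" for x
    have "finite (\<rho> ` K)"
    proof (rule finite_subset)
      show "\<rho> ` K \<subseteq> ((#>) L ` carrier G) \<times> ((#>) L ` carrier G)"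
        using KD by (auto simp: \<rho>_def)
    qed (use L(4) in \<open>simp add: finite_index_def\<close>)
    then obtain T where T: "T \<subseteq> K" "finite T"
      "\<rho> ` K = \<rho> ` T"
      by (meson finite_subset_image order_refl)
    have cosets: "\<exists>t\<in>T. inv\<^bsub>D\<^esub> t \<otimes>\<^bsub>D\<^esub> x \<in> C" if x: "x \<in> K" for x
    proof -
      have "\<rho> x \<in> \<rho> ` T" using T(3) x by blast
      then obtain t where "\<rho> x = \<rho> t" "t \<in> T" by (rule imageE)
      then have t: "t \<in> T" "L #> inv (\<phi> t) = L #> inv (\<phi> x)" "L #> inv (\<psi> t) = L #> inv (\<psi> x)"
        by (simp_all add: \<rho>_def)
      have "t \<in> K" using t T by blast
      then have "inv\<^bsub>D\<^esub> t \<otimes>\<^bsub>D\<^esub> x \<in> C"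
        using t x KD sL subgroup.m_closed[OF down.prems(1) subgroup.m_inv_closed[OF down.prems(1)]]
        by (simp add: C_def rcos_eq_iff)
      then show ?thesis using t(1) by blast
    qed
    \<comment> \<open>With constant \<one> the question on the coset \<open>t C\<close> is whether
      the two maps agree somewhere modulo \<open>M'\<close>. Translation by \<open>t\<close> reduces
      it to the hypothesis for the subgroup \<open>C\<close>.\<close>
    have "\<exists>N. N \<lhd> G \<and> finite_index N \<and> M' \<subseteq> N \<and>
        ((\<forall>c\<in>C. M' #> \<phi> (t \<otimes>\<^bsub>D\<^esub> c) \<noteq> M' #> (\<one> \<otimes> \<psi> (t \<otimes>\<^bsub>D\<^esub> c))) \<longrightarrow>
         (\<forall>c\<in>C. N #> \<phi> (t \<otimes>\<^bsub>D\<^esub> c) \<noteq> N #> (\<one> \<otimes> \<psi> (t \<otimes>\<^bsub>D\<^esub> c))))" if "t \<in> T" for t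
    proof (cases "\<forall>c\<in>C. M' #> \<phi> (t \<otimes>\<^bsub>D\<^esub> c) \<noteq> M' #> (\<one> \<otimes> \<psi> (t \<otimes>\<^bsub>D\<^esub> c))")
      case True
      have tc: "t \<in> carrier D" using that T(1) KD by blast
      have cc: "c \<in> carrier D" if "c \<in> C" for c using that KD by (simp add: C_def)
      have "\<forall>c\<in>C. M' #> \<phi> c \<noteq> M' #> (inv (\<phi> t) \<otimes> \<one> \<otimes> \<psi> t \<otimes> \<psi> c)"
        using True rcos_twist_shift[OF nM' f g tc cc one_closed] by blast
      from down.IH[OF sC _ this] obtain N where N: "N \<lhd> G" "finite_index N" "M' \<subseteq> N"
        "\<forall>c\<in>C. N #> \<phi> c \<noteq> N #> (inv (\<phi> t) \<otimes> \<one> \<otimes> \<psi> t \<otimes> \<psi> c)" using tc by auto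
      have "\<forall>c\<in>C. N #> \<phi> (t \<otimes>\<^bsub>D\<^esub> c) \<noteq> N #> (\<one> \<otimes> \<psi> (t \<otimes>\<^bsub>D\<^esub> c))"
        using N(4) rcos_twist_shift[OF N(1) f g tc cc one_closed] by blast
      then show ?thesis using N by blast
    next
      case False
      \<comment> \<open>A coset on which the maps do agree somewhere modulo \<open>M'\<close> needs
        no separation, and the whole group serves.\<close>
      have "finite_index (carrier G)"
        using finite_subset[of "(#>) (carrier G) ` carrier G" "{carrier G}"] coset_join2[OF _ subgroup_self]
        by (auto simp: finite_index_def)
      then show ?thesis using False normal_self subgroup.subset[OF sM'] by blast
    qed
    then obtain N where N: "\<And>t. t \<in> T \<Longrightarrow> N t \<lhd> G \<and> finite_index (N t)" "\<And>t. t \<in> T \<Longrightarrow> M' \<subseteq> N t"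
      "\<And>t. \<lbrakk>t \<in> T; \<forall>c\<in>C. M' #> \<phi> (t \<otimes>\<^bsub>D\<^esub> c) \<noteq> M' #> (\<one> \<otimes> \<psi> (t \<otimes>\<^bsub>D\<^esub> c))\<rbrakk>
        \<Longrightarrow> \<forall>c\<in>C. N t #> \<phi> (t \<otimes>\<^bsub>D\<^esub> c) \<noteq> N t #> (\<one> \<otimes> \<psi> (t \<otimes>\<^bsub>D\<^esub> c))"
      by metis
    let ?N = "\<Inter>(insert L (N ` T))"
    have nN: "?N \<lhd> G \<and> finite_index ?N"
      by (rule finite_index_Inter) (use T(2) L N in auto)
    have sN: "subgroup ?N G" using nN by (blast intro: normal_imp_subgroup)
    have MN: "M \<subseteq> ?N" using \<open>M \<subseteq> A\<close> L(2) D(1) N(2) by blast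
    \<comment> \<open>Suppose \<open>\<phi> x\<close> and \<open>z \<otimes> \<psi> x\<close> agree
      modulo \<open>?N\<close>, with \<open>x\<close> in \<open>t C\<close>. As \<open>z\<close>
      lies in \<open>M'\<close> and hence in \<open>N t\<close>, the maps agree at \<open>x\<close>
      modulo \<open>N t\<close>; by the choice of \<open>N t\<close> they agree modulo
      \<open>M'\<close> at some \<open>h\<close> in \<open>t C\<close>. Then
      \<open>\<phi> h \<otimes> inv (\<psi> h)\<close> lies in \<open>A\<close> and so in
      \<open>L\<close>. Modulo \<open>L\<close> both maps are constant on \<open>t C\<close>, so
      they agree at \<open>x\<close> too, which forces \<open>z\<close> into
      \<open>L\<close>.\<close>
    have zN: "?N #> \<phi> x \<noteq> ?N #> (z \<otimes> \<psi> x)" if x: "x \<in> K" for x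
    proof
      assume eq: "?N #> \<phi> x = ?N #> (z \<otimes> \<psi> x)"
      obtain t where t: "t \<in> T" "inv\<^bsub>D\<^esub> t \<otimes>\<^bsub>D\<^esub> x \<in> C" using cosets[OF x] by blast
      have tK: "t \<in> K" using t T by blast
      have tx: "t \<otimes>\<^bsub>D\<^esub> (inv\<^bsub>D\<^esub> t \<otimes>\<^bsub>D\<^esub> x) = x" using KD[OF tK] KD[OF x] by simp
      have sNt: "subgroup (N t) G" using N(1)[OF t(1)] by (blast intro: normal_imp_subgroup)
      have "N t #> \<phi> x = N t #> (z \<otimes> \<psi> x)"
        using eq KD[OF x] zc t(1) by (intro rcos_mono[OF sN sNt]) auto
      also have "\<dots> = N t #> \<psi> x"
        using KD[OF x] zc subsetD[OF N(2)[OF t(1)] \<open>z \<in> M'\<close>] sNt by (simp add: rcos_eq_iff m_assoc)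
      finally have "N t #> \<phi> (t \<otimes>\<^bsub>D\<^esub> (inv\<^bsub>D\<^esub> t \<otimes>\<^bsub>D\<^esub> x)) = N t #> (\<one> \<otimes> \<psi> (t \<otimes>\<^bsub>D\<^esub> (inv\<^bsub>D\<^esub> t \<otimes>\<^bsub>D\<^esub> x)))"
        using KD[OF x] unfolding tx by simp
      then obtain c where c: "c \<in> C" "M' #> \<phi> (t \<otimes>\<^bsub>D\<^esub> c) = M' #> (\<one> \<otimes> \<psi> (t \<otimes>\<^bsub>D\<^esub> c))"
        using N(3)[OF t(1)] t(2) by blast
      define h where "h = t \<otimes>\<^bsub>D\<^esub> c"
      have cK: "c \<in> K" using c by (simp add: C_def)
      have hK: "h \<in> K" unfolding h_def using tK cK by (rule subgroup.m_closed[OF down.prems(1)])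
      note carr = KD[OF x] KD[OF tK] KD[OF hK] KD[OF cK] zc
      have "\<phi> h \<otimes> inv (\<psi> h) \<in> M'" using c(2) carr sM' by (simp add: rcos_eq_iff flip: h_def)
      moreover have "M #> \<phi> h = M #> (\<phi> h \<otimes> inv (\<psi> h) \<otimes> \<psi> h)" using carr by (simp add: m_assoc)
      ultimately have "\<phi> h \<otimes> inv (\<psi> h) \<in> A" using hK unfolding A_def by blast
      then have hL: "\<phi> h \<otimes> inv (\<psi> h) \<in> L" using L(2) by blast
      obtain Q :: "'a set monoid" and p where Q: "group_hom G Q p"
        "\<forall>x\<in>carrier G. \<forall>y\<in>carrier G. L #> x = L #> y \<longleftrightarrow> p x = p y"
        "\<forall>x\<in>carrier G. x \<in> L \<longleftrightarrow> p x = \<one>\<^bsub>Q\<^esub>"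
        by (rule quotientE[OF L(1)])
      interpret q: group_hom G Q p by fact
      have pL: "p x = \<one>\<^bsub>Q\<^esub>" if "x \<in> L" for x using that Q(3) subgroup.mem_carrier[OF sL] by blast
      have "p (\<phi> c) = \<one>\<^bsub>Q\<^esub>" "p (\<psi> c) = \<one>\<^bsub>Q\<^esub>" using c(1) pL by (simp_all add: C_def)
      moreover have "p (\<phi> h) = p (\<psi> h)"
        using pL[OF hL] carr q.H.mult_inv_eq_one_iff[of "p (\<phi> h)" "p (\<psi> h)"] by simp
      ultimately have t_eq: "p (\<phi> t) = p (\<psi> t)" using carr by (simp add: h_def)
      have "p (\<phi> (inv\<^bsub>D\<^esub> t \<otimes>\<^bsub>D\<^esub> x)) = \<one>\<^bsub>Q\<^esub>" "p (\<psi> (inv\<^bsub>D\<^esub> t \<otimes>\<^bsub>D\<^esub> x)) = \<one>\<^bsub>Q\<^esub>"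
        using t(2) pL by (simp_all add: C_def del: f.hom_mult g.hom_mult)
      then have "p (\<phi> x) = p (\<phi> t)" "p (\<psi> x) = p (\<psi> t)"
        using carr q.H.inv_solve_left[of "\<one>\<^bsub>Q\<^esub>"] by (simp_all add: eq_commute[of "\<one>\<^bsub>Q\<^esub>"])
      moreover have "L #> \<phi> x = L #> (z \<otimes> \<psi> x)"
        using eq carr by (intro rcos_mono[OF sN sL]) auto
      then have "p (\<phi> x) = p z \<otimes>\<^bsub>Q\<^esub> p (\<psi> x)" using carr by (simp add: Q(2))
      ultimately have "p z = \<one>\<^bsub>Q\<^esub>" using t_eq carr by simp
      then show False using L(3) Q(3) zc by blast
    qed
    \<comment> \<open>Undo the translation by \<open>x0\<close>.\<close>
    have "?N #> \<phi> x \<noteq> ?N #> (w \<otimes> \<psi> x)" if x: "x \<in> K" for x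
    proof -
      have "inv\<^bsub>D\<^esub> x0 \<otimes>\<^bsub>D\<^esub> x \<in> K"
        using x0(1) x by (intro subgroup.m_closed[OF down.prems(1)] subgroup.m_inv_closed[OF down.prems(1)])
      moreover have "x0 \<otimes>\<^bsub>D\<^esub> (inv\<^bsub>D\<^esub> x0 \<otimes>\<^bsub>D\<^esub> x) = x" using KD[OF x] KD[OF x0(1)] by simp
      ultimately show ?thesis using shift[of ?N "inv\<^bsub>D\<^esub> x0 \<otimes>\<^bsub>D\<^esub> x"] zN nN by auto
    qed
    then show ?thesis using nN MN by blast
  qed
qed

section \<open>The lower central series of a finitely generated group\<close>

lemma lower_central_normal:
  "lower_central G i \<lhd> G" and lower_central_antimono: "lower_central G (Suc i) \<subseteq> lower_central G i"
proof -
  have "lower_central G i \<lhd> G \<and> lower_central G (Suc i) \<subseteq> lower_central G i \<and> lower_central G (Suc i) \<lhd> G"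
  proof (induction i)
    case 0
    have 1: "commutator h g \<in> carrier G" if "h \<in> carrier G" "g \<in> carrier G" for h g using that by simp
    have 2: "subgroup (lower_central G (Suc 0)) G" by (auto intro!: generate_is_subgroup)
    have 3: "lower_central G (Suc 0) \<subseteq> lower_central G 0"
      using subgroup.subset[OF 2] by simp
    have "lower_central G (Suc 0) \<lhd> G"
      by (rule normal_of_commutators[OF 2]) (use subgroup.subset[OF 2] in \<open>auto intro!: generate.incl\<close>)
    then show ?case using 3 normal_self by simp
  next
    case (Suc i)
    let ?B = "lower_central G (Suc i)"
    have B: "?B \<lhd> G" using Suc by blast
    note sB = normal_imp_subgroup[OF B]
    have sub: "commutator h g \<in> ?B" if "h \<in> ?B" "g \<in> carrier G" for h g
      using subset_centralizer_mod[OF B] that by (auto simp: centralizer_mod_def)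
    have 3: "lower_central G (Suc (Suc i)) \<subseteq> ?B"
      unfolding lower_central.simps(2)[of _ "Suc i"] using sub by (intro generate_subgroup_incl sB) blast
    have 2: "subgroup (lower_central G (Suc (Suc i))) G"
      unfolding lower_central.simps(2)[of _ "Suc i"]
      using sub subgroup.subset[OF sB] by (intro generate_is_subgroup) blast
    have "lower_central G (Suc (Suc i)) \<lhd> G"
    proof (rule normal_of_commutators[OF 2])
      fix b g assume "b \<in> lower_central G (Suc (Suc i))" "g \<in> carrier G"
      then show "commutator b g \<in> lower_central G (Suc (Suc i))"
        using 3 unfolding lower_central.simps(2)[of _ "Suc i"] by (intro generate.incl) blast
    qed
    then show ?case using Suc 3 by blast
  qed
  then show "lower_central G i \<lhd> G" "lower_central G (Suc i) \<subseteq> lower_central G i" by blast+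
qed

lemma commutator_lower_central:
  "h \<in> lower_central G i \<Longrightarrow> g \<in> carrier G \<Longrightarrow> commutator h g \<in> lower_central G (Suc i)"
  by (auto intro: generate.incl)

lemma lower_central_subset_centralizer_mod:
  assumes "lower_central G (Suc i) \<subseteq> B"
  shows "lower_central G i \<subseteq> centralizer_mod B"
  using assms commutator_lower_central subgroup.subset[OF normal_imp_subgroup[OF lower_central_normal[of i]]]
  unfolding centralizer_mod_def by blast

text \<open>The new generators are the commutators of the old ones with \<open>X\<close>. Modulo the
  subgroup \<open>?B\<close> that they generate with the term after next, each \<open>s\<close>
  commutes with \<open>X\<close> and so with \<open>G\<close>; hence all of
  \<open>lower_central G i\<close> is central modulo \<open>?B\<close> and its commutators lie in
  \<open>?B\<close>. This avoids expanding commutators of products.\<close>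

lemma lower_central_finite_generators:
  assumes "finite X" "X \<subseteq> carrier G" "generate G X = carrier G"
  shows "\<exists>S. finite S \<and> S \<subseteq> lower_central G i \<and> lower_central G i \<subseteq> generate G (S \<union> lower_central G (Suc i))"
proof (induction i)
  case 0
  show ?case
    using assms mono_generate[of X "X \<union> lower_central G (Suc 0)"] by (intro exI[of _ X]) auto
next
  case (Suc i)
  then obtain S where S: "finite S" "S \<subseteq> lower_central G i"
    "lower_central G i \<subseteq> generate G (S \<union> lower_central G (Suc i))" by blast
  let ?T = "(\<lambda>(s, x). commutator s x) ` (S \<times> X)"
  let ?B = "generate G (?T \<union> lower_central G (Suc (Suc i)))"
  note sub = subgroup.subset[OF normal_imp_subgroup[OF lower_central_normal]]
  have T: "?T \<subseteq> lower_central G (Suc i)"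
    by (auto simp del: lower_central.simps intro!: commutator_lower_central subsetD[OF S(2)] subsetD[OF assms(2)])
  have lB: "lower_central G (Suc (Suc i)) \<subseteq> ?B" by (auto intro: generate.incl)
  have sB: "subgroup ?B G" using T sub by (intro generate_is_subgroup) blast
  have B: "?B \<subseteq> lower_central G (Suc i)"
    using T lower_central_antimono[of "Suc i"] by (intro generate_subgroup_incl normal_imp_subgroup lower_central_normal) blast
  have nB: "?B \<lhd> G"
  proof (rule normal_of_commutators[OF sB])
    fix b g assume "b \<in> ?B" "g \<in> carrier G"
    then show "commutator b g \<in> ?B" by (rule subsetD[OF lB commutator_lower_central[OF subsetD[OF B]]])
  qed
  obtain Q :: "'a set monoid" and p where Q: "group_hom G Q p"
    "\<forall>x\<in>carrier G. \<forall>y\<in>carrier G. ?B #> x = ?B #> y \<longleftrightarrow> p x = p y"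
    "\<forall>x\<in>carrier G. x \<in> ?B \<longleftrightarrow> p x = \<one>\<^bsub>Q\<^esub>"
    by (rule quotientE[OF nB])
  interpret q: group_hom G Q p by fact
  have "s \<in> centralizer_mod ?B" if s: "s \<in> S" for s
  proof -
    have sc: "s \<in> carrier G" using s S(2) sub by blast
    have "X \<subseteq> {g \<in> carrier G. p s \<otimes>\<^bsub>Q\<^esub> p g = p g \<otimes>\<^bsub>Q\<^esub> p s}"
    proof
      fix x assume x: "x \<in> X"
      then have "commutator s x \<in> ?B" using s by (intro generate.incl) auto
      then show "x \<in> {g \<in> carrier G. p s \<otimes>\<^bsub>Q\<^esub> p g = p g \<otimes>\<^bsub>Q\<^esub> p s}"
        using commutator_mem_iff[OF Q(1,3) sc, of x] x assms(2) by blast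
    qed
    then have "generate G X \<subseteq> {g \<in> carrier G. p s \<otimes>\<^bsub>Q\<^esub> p g = p g \<otimes>\<^bsub>Q\<^esub> p s}"
      by (rule generate_subgroup_incl) (rule commute_subgroup[OF Q(1)], use sc in simp)
    then show ?thesis unfolding centralizer_mod_alt[OF Q(1,3)] assms(3) using sc by blast
  qed
  then have "S \<union> lower_central G (Suc i) \<subseteq> centralizer_mod ?B"
    using lower_central_subset_centralizer_mod[OF lB] by blast
  then have "lower_central G i \<subseteq> centralizer_mod ?B"
    using S(3) generate_subgroup_incl[OF _ subgroup_centralizer_mod[OF nB]] by blast
  then have "lower_central G (Suc i) \<subseteq> ?B"
    unfolding lower_central.simps(2)[of _ i] by (intro generate_subgroup_incl sB) (auto simp: centralizer_mod_def)
  then show ?case using T S(1) assms(1) by (intro exI[of _ ?T]) blast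
qed

text \<open>The generators are adjoined to \<open>B\<close> one at a time. Centrality of
  \<open>C\<close> modulo \<open>B\<close> passes to every larger subgroup, so each intermediate
  step is central, and it is cyclic because it adds one generator.\<close>

lemma central_cyclic_chain_refine:
  assumes "finite S" "central_cyclic_chain C" "S \<subseteq> C"
  shows "\<lbrakk>subgroup B G; B \<subseteq> C; C \<subseteq> centralizer_mod B; C \<subseteq> generate G (S \<union> B)\<rbrakk> \<Longrightarrow> central_cyclic_chain B"
  using assms(1,3)
proof (induction S arbitrary: B)
  case empty
  then have "B = C" using generate_subgroup_incl[of B B] by auto
  then show ?case using assms(2) by simp
next
  case (insert s S)
  let ?B = "generate G (insert s B)"
  note sC = central_cyclic_chain_subgroup[OF assms(2)]
  have sub: "insert s B \<subseteq> C" using insert.prems by blast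
  then have BC: "?B \<subseteq> C" by (rule generate_subgroup_incl) (rule sC)
  have sB: "subgroup ?B G" using sub subgroup.subset[OF sC] by (intro generate_is_subgroup) blast
  have B: "insert s B \<subseteq> ?B" by (auto intro: generate.incl)
  have "central_cyclic_chain ?B"
  proof (rule insert.IH[OF sB BC])
    show "C \<subseteq> centralizer_mod ?B" using insert.prems(3) B unfolding centralizer_mod_def by blast
    show "C \<subseteq> generate G (S \<union> ?B)"
      using insert.prems(4) mono_generate[of "insert s S \<union> B" "S \<union> ?B"] B by blast
    show "S \<subseteq> C" using insert.prems by blast
  qed
  then show ?case
    by (rule central_cyclic_chain.down) (use insert.prems BC in blast)+
qed

lemma central_cyclic_chain_lower_central:
  assumes "finite X" "X \<subseteq> carrier G" "generate G X = carrier G"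
  shows "central_cyclic_chain (lower_central G i)"
proof (induction i)
  case 0
  show ?case by (simp add: central_cyclic_chain.top)
next
  case (Suc i)
  obtain S where S: "finite S" "S \<subseteq> lower_central G i"
    "lower_central G i \<subseteq> generate G (S \<union> lower_central G (Suc i))"
    using lower_central_finite_generators[OF assms] by blast
  show ?case
    by (rule central_cyclic_chain_refine[OF S(1) Suc S(2)])
      (intro normal_imp_subgroup lower_central_normal lower_central_antimono
        lower_central_subset_centralizer_mod S order_refl)+
qed

end

section \<open>Twisted conjugacy of words\<close>

lemma (in group) twisted_conjugate_refl:
  assumes "\<phi> \<in> hom G G" "\<psi> \<in> hom G G" "u \<in> carrier G"
  shows "twisted_conjugate G \<phi> \<psi> u u"
  using assms hom_one[OF assms(1) is_group is_group] hom_one[OF assms(2) is_group is_group] by (auto simp: twisted_conjugate_def intro!: bexI[of _ \<one>])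

lemma (in group) twisted_conjugate_sym:
  assumes "\<phi> \<in> hom G G" "\<psi> \<in> hom G G" "u \<in> carrier G" "v \<in> carrier G" "twisted_conjugate G \<phi> \<psi> u v"
  shows "twisted_conjugate G \<phi> \<psi> v u"
proof -
  interpret f: group_hom G G \<phi> using assms by unfold_locales
  interpret g: group_hom G G \<psi> using assms by unfold_locales
  obtain x where x: "x \<in> carrier G" "\<phi> x \<otimes> u = v \<otimes> \<psi> x"
    using assms(5) by (auto simp: twisted_conjugate_def)
  have "\<phi> (inv x) \<otimes> v = \<phi> (inv x) \<otimes> (v \<otimes> \<psi> x) \<otimes> \<psi> (inv x)"
    using x assms by (simp add: m_assoc)
  also have "\<dots> = u \<otimes> \<psi> (inv x)"
    using x assms by (simp flip: x(2) add: m_assoc)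
  finally show ?thesis unfolding twisted_conjugate_def by (rule bexI) (use x(1) in simp)
qed

lemma (in group) twisted_conjugate_trans:
  assumes "\<phi> \<in> hom G G" "\<psi> \<in> hom G G" "u \<in> carrier G" "v \<in> carrier G" "w \<in> carrier G"
    and "twisted_conjugate G \<phi> \<psi> u v" "twisted_conjugate G \<phi> \<psi> v w"
  shows "twisted_conjugate G \<phi> \<psi> u w"
proof -
  interpret f: group_hom G G \<phi> using assms by unfold_locales
  interpret g: group_hom G G \<psi> using assms by unfold_locales
  obtain x y where x: "x \<in> carrier G" "\<phi> x \<otimes> u = v \<otimes> \<psi> x" and y: "y \<in> carrier G" "\<phi> y \<otimes> v = w \<otimes> \<psi> y"
    using assms(6,7) by (auto simp: twisted_conjugate_def)
  have "\<phi> (y \<otimes> x) \<otimes> u = \<phi> y \<otimes> v \<otimes> \<psi> x" using x y(1) assms(3,4) by (simp add: m_assoc)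
  also have "\<dots> = w \<otimes> \<psi> (y \<otimes> x)" unfolding y(2) using x(1) y(1) assms(5) by (simp add: m_assoc)
  finally show ?thesis unfolding twisted_conjugate_def by (rule bexI) (use x(1) y(1) in simp)
qed

text \<open>On words, twisted conjugacy is generated by the relations of the group and by the moves
  \<open>(a\<^sub>i\<phi>) w \<leftrightarrow> w (a\<^sub>i\<psi>)\<close>, which is twisted conjugation of \<open>w (a\<^sub>i\<psi>)\<close> by \<open>a\<^sub>i\<close>.\<close>

inductive twist_step :: "nat \<Rightarrow> word set \<Rightarrow> word list \<Rightarrow> word list \<Rightarrow> word \<Rightarrow> word \<Rightarrow> bool"
  for n R ps qs where
  relation: "\<lbrakk>p \<in> words n; q \<in> words n; r \<in> R \<union> (\<lambda>a. [a, inv_letter a]) ` letters n; r \<in> words n\<rbrakk>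
    \<Longrightarrow> twist_step n R ps qs (p @ r @ q) (p @ q)"
| twist: "\<lbrakk>i < n; w \<in> words n\<rbrakk> \<Longrightarrow> twist_step n R ps qs (ps ! i @ w) (w @ qs ! i)"

locale endomorphism_pair =
  fixes n :: nat and R :: "word set" and ps qs :: "word list" and \<phi> \<psi> :: "word set \<Rightarrow> word set"
  assumes phi: "endo_given_by n R ps \<phi>" and psi: "endo_given_by n R qs \<psi>"
begin

abbreviation "G \<equiv> presented_group n R"
abbreviation "cl \<equiv> word_class n R"
abbreviation "conj_eq \<equiv> equivclp (twist_step n R ps qs)"

sublocale G: group G by (rule group_presented_group)

lemma hom: "\<phi> \<in> hom G G" "\<psi> \<in> hom G G"
  using phi psi by (auto simp: endo_given_by_def)

sublocale f: group_hom G G \<phi> using hom(1) by unfold_locales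
sublocale g: group_hom G G \<psi> using hom(2) by unfold_locales

lemma image_words: "i < n \<Longrightarrow> ps ! i \<in> words n" "i < n \<Longrightarrow> qs ! i \<in> words n"
  using phi psi unfolding endo_given_by_def by (metis nth_mem subsetD)+

lemma images: "i < n \<Longrightarrow> \<phi> (cl [Pos i]) = cl (ps ! i)" "i < n \<Longrightarrow> \<psi> (cl [Pos i]) = cl (qs ! i)"
  using phi psi by (auto simp: endo_given_by_def)

lemma cl_carrier [simp]: "w \<in> words n \<Longrightarrow> cl w \<in> carrier G"
  by (simp add: carrier_presented_group)

lemma carrierE:
  assumes "x \<in> carrier G"
  obtains w where "w \<in> words n" "x = cl w"
  using assms by (auto simp: carrier_presented_group)

lemma twist_step_words: "twist_step n R ps qs w w' \<Longrightarrow> w \<in> words n \<and> w' \<in> words n"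
  by (induction rule: twist_step.induct) (auto dest: image_words)

lemma Pos_words: "i < n \<Longrightarrow> [Pos i] \<in> words n" and Neg_words: "i < n \<Longrightarrow> [Neg i] \<in> words n"
  by (auto simp: letters_def)

lemma twist_step_twisted_conjugate:
  assumes "twist_step n R ps qs w w'"
  shows "twisted_conjugate G \<phi> \<psi> (cl w') (cl w)"
  using assms
proof cases
  case (relation p q r)
  have "(w, w') \<in> pres_rel n R"
    using relation(5)
  proof
    assume "r \<in> R"
    then show ?thesis unfolding relation(1,2) by (intro pres_rel.relator relation)
  next
    assume "r \<in> (\<lambda>a. [a, inv_letter a]) ` letters n"
    then show ?thesis unfolding relation(1,2) by (auto intro!: pres_rel.cancel[simplified] relation(3,4)[simplified])
  qed
  then have "cl w = cl w'" using relation by (simp add: word_class_eq_iff)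
  then show ?thesis using G.twisted_conjugate_refl[OF hom] relation by simp
next
  case (twist i x)
  have "\<phi> (cl [Pos i]) \<otimes>\<^bsub>G\<^esub> cl w' = cl w \<otimes>\<^bsub>G\<^esub> \<psi> (cl [Pos i])"
    using twist image_words[of i] by (simp add: images mult_word_class)
  then show ?thesis unfolding twisted_conjugate_def using Pos_words[OF twist(3)] cl_carrier by blast
qed

lemma conj_eq_sound:
  assumes "conj_eq u v" "u \<in> words n"
  shows "twisted_conjugate G \<phi> \<psi> (cl u) (cl v)"
  using assms
proof (induction rule: equivclp_induct)
  case base
  then show ?case by (simp add: G.twisted_conjugate_refl hom)
next
  case (step v w)
  have v: "v \<in> words n" and w: "w \<in> words n" using step(2) twist_step_words by blast+
  have "twisted_conjugate G \<phi> \<psi> (cl v) (cl w)"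
    using step(2) twist_step_twisted_conjugate G.twisted_conjugate_sym[OF hom] cl_carrier[OF v] cl_carrier[OF w] by blast
  then show ?case
    using G.twisted_conjugate_trans[OF hom] step.IH[OF step.prems] step.prems cl_carrier[OF v] cl_carrier[OF w] cl_carrier by blast
qed

lemma pres_rel_imp_conj_eq: "(u, v) \<in> pres_rel n R \<Longrightarrow> conj_eq u v"
proof (induction rule: pres_rel.induct)
  case (cancel u v a)
  then have "twist_step n R ps qs (u @ [a, inv_letter a] @ v) (u @ v)" by (intro twist_step.relation) auto
  then show ?case by (rule r_into_equivclp)
next
  case (relator u v r)
  then have "twist_step n R ps qs (u @ r @ v) (u @ v)" by (intro twist_step.relation) auto
  then show ?case by (rule r_into_equivclp)
qed (auto intro: equivclp_sym equivclp_trans)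

text \<open>With a word \<open>q\<close> for the inverse of \<open>a\<^sub>i\<psi>\<close>, the
  equation says that \<open>v\<close> equals \<open>(a\<^sub>i\<phi>) w q\<close> in the group. One
  move takes this to \<open>w q (a\<^sub>i\<psi>)\<close>, which equals \<open>w\<close>.\<close>

lemma conj_eq_generator:
  assumes "i < n" "w \<in> words n" "v \<in> words n" "\<phi> (cl [Pos i]) \<otimes>\<^bsub>G\<^esub> cl w = cl v \<otimes>\<^bsub>G\<^esub> \<psi> (cl [Pos i])"
  shows "conj_eq w v"
proof -
  note im = image_words[OF assms(1)]
  have "inv\<^bsub>G\<^esub> cl (qs ! i) \<in> carrier G" using im(2) by simp
  then obtain q where q: "q \<in> words n" "inv\<^bsub>G\<^esub> cl (qs ! i) = cl q" by (rule carrierE)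
  have "cl (ps ! i @ w @ q) = cl (ps ! i) \<otimes>\<^bsub>G\<^esub> cl w \<otimes>\<^bsub>G\<^esub> cl q"
    using assms(2) im q by (simp add: mult_word_class)
  then have "cl (ps ! i @ w @ q) = cl v \<otimes>\<^bsub>G\<^esub> cl (qs ! i) \<otimes>\<^bsub>G\<^esub> inv\<^bsub>G\<^esub> cl (qs ! i)"
    using assms(4) by (simp only: images[OF assms(1)] q(2))
  also have "\<dots> = cl v" using assms(3) im(2) by (simp add: G.m_assoc)
  finally have 1: "conj_eq v (ps ! i @ w @ q)"
    using assms(2,3) im q(1) by (intro pres_rel_imp_conj_eq) (simp flip: word_class_eq_iff)
  have 2: "conj_eq (ps ! i @ w @ q) ((w @ q) @ qs ! i)"
    using assms(1,2) q by (intro r_into_equivclp twist_step.twist) auto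
  have "cl ((w @ q) @ qs ! i) = cl w \<otimes>\<^bsub>G\<^esub> inv\<^bsub>G\<^esub> cl (qs ! i) \<otimes>\<^bsub>G\<^esub> cl (qs ! i)"
    using assms(2) im q by (simp add: mult_word_class)
  also have "\<dots> = cl w" using assms(2) im(2) by (simp add: G.m_assoc)
  finally have "conj_eq ((w @ q) @ qs ! i) w"
    using assms(2) im q(1) by (intro pres_rel_imp_conj_eq) (simp flip: word_class_eq_iff)
  with 1 2 show ?thesis by (meson equivclp_sym equivclp_trans)
qed

text \<open>The letters act one after the other: the tail of \<open>x\<close> takes \<open>u\<close>
  to an intermediate word \<open>w\<close>, and the first letter takes \<open>w\<close> to
  \<open>v\<close>.\<close>

lemma conj_eq_of_word:
  "\<lbrakk>x \<in> words n; u \<in> words n; v \<in> words n; \<phi> (cl x) \<otimes>\<^bsub>G\<^esub> cl u = cl v \<otimes>\<^bsub>G\<^esub> \<psi> (cl x)\<rbrakk> \<Longrightarrow> conj_eq u v"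
proof (induction x arbitrary: v)
  case Nil
  have one: "cl [] = \<one>\<^bsub>G\<^esub>" by (simp only: one_presented_group)
  have "cl u = cl v" using Nil.prems(4)[unfolded one f.hom_one g.hom_one] Nil.prems(2,3) by simp
  then show ?case using Nil by (intro pres_rel_imp_conj_eq) (simp flip: word_class_eq_iff)
next
  case (Cons a x)
  have a: "[a] \<in> words n" and x: "x \<in> words n" using Cons.prems(1) by auto
  have "\<phi> (cl x) \<otimes>\<^bsub>G\<^esub> cl u \<otimes>\<^bsub>G\<^esub> inv\<^bsub>G\<^esub> \<psi> (cl x) \<in> carrier G"
    using x Cons.prems(2) by simp
  then obtain w where w: "w \<in> words n" "\<phi> (cl x) \<otimes>\<^bsub>G\<^esub> cl u \<otimes>\<^bsub>G\<^esub> inv\<^bsub>G\<^esub> \<psi> (cl x) = cl w"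
    by (rule carrierE)
  have 1: "\<phi> (cl x) \<otimes>\<^bsub>G\<^esub> cl u = cl w \<otimes>\<^bsub>G\<^esub> \<psi> (cl x)"
    using x Cons.prems(2) by (simp flip: w(2) add: G.m_assoc)
  then have uw: "conj_eq u w" using x w Cons.prems(2) by (intro Cons.IH)
  have ax: "cl (a # x) = cl [a] \<otimes>\<^bsub>G\<^esub> cl x" using a x by (simp add: mult_word_class)
  have "\<phi> (cl [a]) \<otimes>\<^bsub>G\<^esub> cl w \<otimes>\<^bsub>G\<^esub> \<psi> (cl x) = cl v \<otimes>\<^bsub>G\<^esub> \<psi> (cl [a]) \<otimes>\<^bsub>G\<^esub> \<psi> (cl x)"
    using Cons.prems(2-4) a x w(1) by (simp add: ax G.m_assoc flip: 1)
  then have aw: "\<phi> (cl [a]) \<otimes>\<^bsub>G\<^esub> cl w = cl v \<otimes>\<^bsub>G\<^esub> \<psi> (cl [a])"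
    using Cons.prems(3) a x w(1) by simp
  have "conj_eq w v"
  proof (cases a)
    case (Pos i)
    then show ?thesis using a aw w(1) Cons.prems(3) by (intro conj_eq_generator[of i]) (auto simp: letters_def)
  next
    \<comment> \<open>Moves exist for generators only. Multiplying both sides by the images of
      \<open>a\<^sub>i\<close> turns the equation into one for \<open>a\<^sub>i\<close> with
      \<open>v\<close> and \<open>w\<close> exchanged.\<close>
    case (Neg i)
    then have i: "i < n" using a by (auto simp: letters_def)
    have "cl [Pos i] \<otimes>\<^bsub>G\<^esub> cl [a] = \<one>\<^bsub>G\<^esub>"
      using pres_rel.cancel[of "[]" n "[]" "Pos i" R] i Pos_words[OF i] Neg_words[OF i] Neg
      by (simp add: mult_word_class one_presented_group word_class_eq_iff)
    then have inv: "cl [a] = inv\<^bsub>G\<^esub> cl [Pos i]"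
      using a Pos_words[OF i] by (metis G.inv_equality G.inv_inv G.inv_closed cl_carrier)
    have c: "cl [Pos i] \<in> carrier G" using Pos_words[OF i] by simp
    have "\<phi> (cl [Pos i]) \<otimes>\<^bsub>G\<^esub> (\<phi> (cl [a]) \<otimes>\<^bsub>G\<^esub> cl w) \<otimes>\<^bsub>G\<^esub> \<psi> (cl [Pos i])
        = \<phi> (cl [Pos i]) \<otimes>\<^bsub>G\<^esub> (cl v \<otimes>\<^bsub>G\<^esub> \<psi> (cl [a])) \<otimes>\<^bsub>G\<^esub> \<psi> (cl [Pos i])"
      using aw by simp
    then have "cl w \<otimes>\<^bsub>G\<^esub> \<psi> (cl [Pos i]) = \<phi> (cl [Pos i]) \<otimes>\<^bsub>G\<^esub> cl v"
      using c w(1) Cons.prems(3) by (simp add: inv G.m_assoc)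
    then have "conj_eq v w" using i w(1) Cons.prems(3) by (intro conj_eq_generator[of i]) simp_all
    then show ?thesis by (rule equivclp_sym)
  qed
  with uw show ?case by (rule equivclp_trans)
qed

theorem twisted_conjugate_iff_conj_eq:
  assumes "u \<in> words n" "v \<in> words n"
  shows "twisted_conjugate G \<phi> \<psi> (cl u) (cl v) \<longleftrightarrow> conj_eq u v"
  using assms conj_eq_sound conj_eq_of_word carrierE unfolding twisted_conjugate_def by metis

end

section \<open>Certificates\<close>

text \<open>Applied to \<open>word_code\<close>, this turns the quantifiers over numbers in
  \<open>code_step\<close> into quantifiers over words: every number codes a word, so none has to be
  rejected.\<close>

lemma surj_ex: "surj f \<Longrightarrow> (\<exists>c. P c) \<longleftrightarrow> (\<exists>x. P (f x))"
  by (metis surjD)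

lemma inj_letter_code: "inj letter_code"
proof (rule injI)
  show "x = y" if "letter_code x = letter_code y" for x y
    using that by (cases x; cases y) (auto, presburger+)
qed

lemma surj_letter_code: "surj letter_code"
proof (rule surjI)
  show "letter_code (if even m then Pos (m div 2) else Neg (m div 2)) = m" for m by auto
qed

lemma letter_code_less_iff: "letter_code a < n + n \<longleftrightarrow> a \<in> letters n"
  by (cases a) (auto simp: letters_def)

lemma word_code_eq_iff [simp]: "word_code v = word_code w \<longleftrightarrow> v = w"
  by (simp add: word_code_def list_encode_eq inj_map_eq_map[OF inj_letter_code])

lemma surj_word_code: "surj word_code"
proof (rule surjI)
  show "word_code (map (inv_into UNIV letter_code) (list_decode c)) = c" for c
    by (simp add: word_code_def comp_def surj_f_inv_f[OF surj_letter_code])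
qed

lemma len_word_code [simp]: "len (word_code w) = length w"
  by (simp add: word_code_def)

lemma at_word_code [simp]: "i < length w \<Longrightarrow> at (word_code w) i = letter_code (w ! i)"
  by (simp add: word_code_def)

lemma len_words_code [simp]: "len (words_code ws) = length ws"
  by (simp add: words_code_def)

lemma at_words_code [simp]: "i < length ws \<Longrightarrow> at (words_code ws) i = word_code (ws ! i)"
  by (simp add: words_code_def)

lemma appendc_word_code [simp]: "appendc (word_code v) (word_code w) = word_code (v @ w)"
  by (simp add: word_code_def)

definition is_word :: "nat \<Rightarrow> nat \<Rightarrow> bool" where
  "is_word n c \<longleftrightarrow> (\<forall>i<len c. at c i < n + n)"

lemma is_word_word_code [simp]: "is_word n (word_code w) \<longleftrightarrow> w \<in> words n"
  by (simp add: is_word_def letter_code_less_iff in_lists_conv_set all_set_conv_all_nth)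

text \<open>\<open>list_encode\<close> unfolded on a list of length two, so that recursiveness can
  be read off.\<close>

definition pair_code :: "nat \<Rightarrow> nat \<Rightarrow> nat" where
  "pair_code a b = Suc (prod_encode (a, Suc (prod_encode (b, 0))))"

lemma pair_code_word_code: "pair_code (letter_code a) (letter_code b) = word_code [a, b]"
  by (simp add: pair_code_def word_code_def)

definition is_relation :: "nat \<Rightarrow> nat \<Rightarrow> nat \<Rightarrow> bool" where
  "is_relation n rs r \<longleftrightarrow> (\<exists>j. j < len rs \<and> r = at rs j) \<or>
    (\<exists>i. i < n \<and> (r = pair_code (i + i) (Suc (i + i)) \<or> r = pair_code (Suc (i + i)) (i + i)))"

lemma is_relation_word_code:
  "is_relation n (words_code rs) (word_code r) \<longleftrightarrow> r \<in> set rs \<union> (\<lambda>a. [a, inv_letter a]) ` letters n"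
proof -
  have "pair_code (i + i) (Suc (i + i)) = word_code [Pos i, Neg i]"
    "pair_code (Suc (i + i)) (i + i) = word_code [Neg i, Pos i]" for i
    by (simp_all add: mult_2 flip: pair_code_word_code)
  then have "is_relation n (words_code rs) (word_code r) \<longleftrightarrow>
      (\<exists>j<length rs. r = rs ! j) \<or> (\<exists>i<n. r = [Pos i, Neg i] \<or> r = [Neg i, Pos i])"
    by (auto simp: is_relation_def)
  also have "\<dots> \<longleftrightarrow> r \<in> set rs \<union> (\<lambda>a. [a, inv_letter a]) ` letters n"
    by (auto simp: letters_def in_set_conv_nth)
  finally show ?thesis .
qed

definition code_step :: "nat \<Rightarrow> nat \<Rightarrow> nat \<Rightarrow> nat \<Rightarrow> nat \<Rightarrow> nat \<Rightarrow> bool" where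
  "code_step n rs ps qs c d \<longleftrightarrow>
    (\<exists>p q r. is_relation n rs r \<and> is_word n (appendc p (appendc r q))
      \<and> c = appendc p (appendc r q) \<and> d = appendc p q) \<or>
    (\<exists>i w. i < n \<and> is_word n w \<and> c = appendc (at ps i) w \<and> d = appendc w (at qs i))"

lemma code_step_word_code:
  assumes "length ps = n" "length qs = n"
  shows "code_step n (words_code rs) (words_code ps) (words_code qs) (word_code v) (word_code w)
    \<longleftrightarrow> twist_step n (set rs) ps qs v w"
  unfolding code_step_def surj_ex[OF surj_word_code] twist_step.simps
  using assms by (auto simp: is_relation_word_code[simplified]) blast+

lemma code_step_rtranclp:
  assumes "length ps = n" "length qs = n"
  shows "(\<lambda>c d. code_step n (words_code rs) (words_code ps) (words_code qs) c d \<or>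
      code_step n (words_code rs) (words_code ps) (words_code qs) d c)\<^sup>*\<^sup>* (word_code u) (word_code v)
    \<longleftrightarrow> equivclp (twist_step n (set rs) ps qs) u v" (is "?S\<^sup>*\<^sup>* _ _ \<longleftrightarrow> _")
proof
  have "\<exists>v. d = word_code v \<and> equivclp (twist_step n (set rs) ps qs) u v" if "?S\<^sup>*\<^sup>* (word_code u) d" for d
    using that
  proof (induction rule: rtranclp_induct)
    case (step c d)
    then obtain v w where "c = word_code v" "d = word_code w" "equivclp (twist_step n (set rs) ps qs) u v"
      using surj_word_code by (metis surjD)
    then show ?case
      using step(2) code_step_word_code[OF assms] by (auto intro: equivclp_into_equivclp)
  qed auto
  then show "?S\<^sup>*\<^sup>* (word_code u) (word_code v) \<Longrightarrow> equivclp (twist_step n (set rs) ps qs) u v" by force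
next
  assume "equivclp (twist_step n (set rs) ps qs) u v"
  then show "?S\<^sup>*\<^sup>* (word_code u) (word_code v)"
  proof (induction rule: equivclp_induct)
    case (step v w)
    then show ?case using code_step_word_code[OF assms] by (blast intro: rtranclp.rtrancl_into_rtrancl)
  qed simp
qed

text \<open>A word is read as by an automaton whose states are the monoid elements, each letter
  multiplying from the right. Recursion over positions brings it under
  \<open>recursive_rec_nat\<close>.\<close>

definition run :: "nat \<Rightarrow> nat \<Rightarrow> nat \<Rightarrow> nat \<Rightarrow> nat" where
  "run m h o' c = rec_nat o' (\<lambda>i s. at (at m s) (at h (at c i))) (len c)"

lemma rec_nat_eq_foldl: "rec_nat s (\<lambda>i s. F s (xs ! i)) (length xs) = foldl F s xs"
proof (induction xs rule: rev_induct)
  case (snoc x xs)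
  have "rec_nat s (\<lambda>i s. F s ((xs @ [x]) ! i)) k = rec_nat s (\<lambda>i s. F s (xs ! i)) k" if "k \<le> length xs" for k
    using that by (induction k) (auto simp: nth_append)
  then show ?case using snoc by simp
qed simp

lemma run_word_code: "run m h s (word_code w) = foldl (\<lambda>s a. at (at m s) (at h (letter_code a))) s w"
proof -
  have "rec_nat s (\<lambda>i s. at (at m s) (at h (at (word_code w) i))) k =
      rec_nat s (\<lambda>i s. at (at m s) (at h (letter_code (w ! i)))) k" if "k \<le> length w" for k
    using that by (induction k) auto
  then show ?thesis by (simp add: run_def rec_nat_eq_foldl[of s "\<lambda>s a. at (at m s) (at h (letter_code a))"])
qed

text \<open>\<open>m\<close> is the multiplication table of a monoid on \<open>{..<k}\<close> with unit \<open>e\<close>, \<open>h\<close> gives the images of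
  the letters under a homomorphism from the group to it, and \<open>x\<close> a colouring that is constant on twisted
  conjugacy classes.\<close>

definition separating ::
  "nat \<Rightarrow> nat \<Rightarrow> nat \<Rightarrow> nat \<Rightarrow> nat \<Rightarrow> nat \<Rightarrow> nat \<Rightarrow> nat \<Rightarrow> nat \<Rightarrow> nat \<Rightarrow> nat \<Rightarrow> bool" where
  "separating n rs ps qs u v k e m h x \<longleftrightarrow>
    e < k \<and> (\<forall>a<k. \<forall>b<k. at (at m a) b < k) \<and>
    (\<forall>a<k. \<forall>b<k. \<forall>c<k. at (at m (at (at m a) b)) c = at (at m a) (at (at m b) c)) \<and>
    (\<forall>a<k. at (at m e) a = a \<and> at (at m a) e = a) \<and>
    (\<forall>a<n + n. at h a < k) \<and>
    (\<forall>i<n. at (at m (at h (i + i))) (at h (Suc (i + i))) = e \<and> at (at m (at h (Suc (i + i)))) (at h (i + i)) = e) \<and>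
    (\<forall>j<len rs. run m h e (at rs j) = e) \<and>
    (\<forall>i<n. \<forall>s<k. at x (at (at m (run m h e (at ps i))) s) = at x (at (at m s) (run m h e (at qs i)))) \<and>
    at x (run m h e u) \<noteq> at x (run m h e v)"

text \<open>Relations do not change the image of a word in the monoid. A move changes it from
  \<open>(a\<^sub>i\<phi>) s\<close> to \<open>s (a\<^sub>i\<psi>)\<close>, a difference that the
  colouring does not see. Hence the colour is constant on classes.\<close>

lemma separating_not_conj_eq:
  assumes sep: "separating n (words_code rs) (words_code ps) (words_code qs) (word_code u) (word_code v) k e m h x"
    and len: "length ps = n" "length qs = n" "set ps \<subseteq> words n" "set qs \<subseteq> words n" and u: "u \<in> words n"
  shows "\<not> equivclp (twist_step n (set rs) ps qs) u v"
proof
  define mul where "mul a b = at (at m a) b" for a b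
  define r where "r w = run m h e (word_code w)" for w
  note S = sep[unfolded separating_def, folded mul_def]
  have e: "e < k" and mul: "\<And>a b. a < k \<Longrightarrow> b < k \<Longrightarrow> mul a b < k"
    and assoc: "\<And>a b c. a < k \<Longrightarrow> b < k \<Longrightarrow> c < k \<Longrightarrow> mul (mul a b) c = mul a (mul b c)"
    and unit: "\<And>a. a < k \<Longrightarrow> mul e a = a \<and> mul a e = a"
    and h: "\<And>a. a < n + n \<Longrightarrow> at h a < k"
    and inv: "\<And>i. i < n \<Longrightarrow> mul (at h (i + i)) (at h (Suc (i + i))) = e \<and> mul (at h (Suc (i + i))) (at h (i + i)) = e"
    using S by blast+
  have rel: "\<And>j. j < length rs \<Longrightarrow> r (rs ! j) = e"
    and col: "\<And>i s. i < n \<Longrightarrow> s < k \<Longrightarrow> at x (mul (r (ps ! i)) s) = at x (mul s (r (qs ! i)))"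
    and ne: "at x (r u) \<noteq> at x (r v)"
    using S len by (auto simp: r_def)
  have hl: "at h (letter_code a) < k" if "a \<in> letters n" for a using that h by (simp add: letter_code_less_iff)
  have rn: "r w = foldl (\<lambda>s a. mul s (at h (letter_code a))) e w" for w
    by (simp add: r_def run_word_code mul_def)
  have r_snoc: "r (w @ [a]) = mul (r w) (at h (letter_code a))" for w a by (simp add: rn)
  have rk: "r w < k" if "w \<in> words n" for w
    using that by (induction w rule: rev_induct) (auto simp: r_snoc e mul hl, simp add: rn e)
  have app: "r (w @ w') = mul (r w) (r w')" if "w \<in> words n" "w' \<in> words n" for w w'
    using that
  proof (induction w' rule: rev_induct)
    case Nil
    then show ?case using unit rk by (simp add: rn[of "[]"])
  next
    case (snoc a w')
    then show ?case using assoc rk hl by (simp add: r_snoc flip: append_assoc)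
  qed
  have single: "r [a] = at h (letter_code a)" if "a \<in> letters n" for a
    using that unit hl by (simp add: rn)
  have step: "at x (r w) = at x (r w')" if "twist_step n (set rs) ps qs w w'" for w w'
    using that
  proof cases
    case (relation p q t)
    have "r t = e"
    proof (cases "t \<in> set rs")
      case True
      then show ?thesis using rel by (auto simp: in_set_conv_nth)
    next
      case False
      then obtain a where a: "a \<in> letters n" "t = [a] @ [inv_letter a]" using relation by auto
      then have "r t = mul (at h (letter_code a)) (at h (letter_code (inv_letter a)))"
        by (subst a(2), subst app) (simp_all add: single)
      also have "\<dots> = e" using a(1) inv by (cases a) (auto simp: letters_def mult_2)
      finally show ?thesis .
    qed
    then have "r w = r w'" using relation unit rk by (simp add: app)
    then show ?thesis by simp
  next
    case (twist i z)
    then have "ps ! i \<in> words n" "qs ! i \<in> words n" using len by (metis nth_mem subsetD)+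
    then show ?thesis using twist col rk by (simp add: app)
  qed
  assume "equivclp (twist_step n (set rs) ps qs) u v"
  then have "at x (r u) = at x (r v)"
    by (induction rule: equivclp_induct) (auto dest: step)
  then show False using ne by simp
qed

text \<open>The colour of an element of \<open>Q\<close> records whether it lies in the image of the
  twisted conjugacy class of \<open>u\<close>. Here \<open>x\<close> ranges over \<open>G\<close>
  rather than \<open>Q\<close>, so \<phi> and \<psi> need not descend to \<open>Q\<close>.\<close>

lemma (in endomorphism_pair) ex_separating:
  fixes Q :: "'b monoid"
  assumes Q: "group_hom G Q p" "finite (carrier Q)" and R: "R = set rs" "set rs \<subseteq> words n"
    and uv: "u \<in> words n" "v \<in> words n"
    and sep: "\<And>x. x \<in> carrier G \<Longrightarrow> p (\<phi> x \<otimes>\<^bsub>G\<^esub> cl u) \<noteq> p (cl v \<otimes>\<^bsub>G\<^esub> \<psi> x)"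
  shows "\<exists>k e m h x. separating n (words_code rs) (words_code ps) (words_code qs) (word_code u) (word_code v) k e m h x"
proof -
  interpret q: group_hom G Q p by fact
  define k where "k = card (carrier Q)"
  obtain c where c: "bij_betw c (carrier Q) {0..<k}"
    using ex_bij_betw_finite_nat[OF Q(2)] unfolding k_def by blast
  define d where "d = inv_into (carrier Q) c"
  have ck: "c s < k" if "s \<in> carrier Q" for s using bij_betwE[OF c] that by auto
  have dc: "d (c s) = s" if "s \<in> carrier Q" for s
    using that c unfolding d_def by (simp add: bij_betw_def)
  have dQ: "d a \<in> carrier Q" and cd: "c (d a) = a" if "a < k" for a
    using that bij_betwE[OF bij_betw_inv_into[OF c]] bij_betw_inv_into_right[OF c] by (auto simp: d_def)
  have "\<exists>l. \<forall>b<k. at l b = c (d a \<otimes>\<^bsub>Q\<^esub> d b)" for a by (rule ex_at)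
  then obtain row where row: "\<And>a b. b < k \<Longrightarrow> at (row a) b = c (d a \<otimes>\<^bsub>Q\<^esub> d b)" by metis
  obtain m where m: "\<forall>a<k. at m a = row a" using ex_at by blast
  have mul: "at (at m a) b = c (d a \<otimes>\<^bsub>Q\<^esub> d b)" if "a < k" "b < k" for a b using m row that by simp
  obtain h where h: "\<forall>a<n + n. at h a = c (p (cl [inv_into UNIV letter_code a]))"
    using ex_at[of "n + n" "\<lambda>a. c (p (cl [inv_into UNIV letter_code a]))"] by blast
  have hl: "at h (letter_code a) = c (p (cl [a]))" if "a \<in> letters n" for a
    using h that by (simp add: letter_code_less_iff inv_f_f[OF inj_letter_code])
  define col where "col s \<longleftrightarrow> (\<exists>x\<in>carrier G. s = p (\<phi> x \<otimes>\<^bsub>G\<^esub> cl u \<otimes>\<^bsub>G\<^esub> inv\<^bsub>G\<^esub> \<psi> x))" for s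
  obtain x where x: "\<forall>a<k. at x a = of_bool (col (d a))"
    using ex_at[of k "\<lambda>a. of_bool (col (d a))"] by blast
  let ?e = "c \<one>\<^bsub>Q\<^esub>"
  have run: "run m h ?e (word_code w) = c (p (cl w))" if "w \<in> words n" for w
    using that
  proof (induction w rule: rev_induct)
    case Nil
    have "p (cl []) = \<one>\<^bsub>Q\<^esub>" using q.hom_one by (simp add: one_presented_group)
    then show ?case by (simp add: run_word_code)
  next
    case (snoc a w)
    then have "p (cl (w @ [a])) = p (cl w) \<otimes>\<^bsub>Q\<^esub> p (cl [a])" by (simp flip: mult_word_class)
    then show ?case using snoc by (simp add: run_word_code hl mul ck dc)
  qed
  have cancel: "p (cl [a]) \<otimes>\<^bsub>Q\<^esub> p (cl [inv_letter a]) = \<one>\<^bsub>Q\<^esub>" if "a \<in> letters n" for a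
  proof -
    have "cl [a, inv_letter a] = \<one>\<^bsub>G\<^esub>"
      using pres_rel.cancel[of "[]" n "[]" a R] that by (simp add: one_presented_group word_class_eq_iff)
    moreover have "cl [a, inv_letter a] = cl [a] \<otimes>\<^bsub>G\<^esub> cl [inv_letter a]" using that by (simp add: mult_word_class)
    ultimately show ?thesis using that q.hom_mult[of "cl [a]" "cl [inv_letter a]"] q.hom_one by simp
  qed
  have inv: "at (at m (at h (i + i))) (at h (Suc (i + i))) = ?e \<and> at (at m (at h (Suc (i + i)))) (at h (i + i)) = ?e"
    if "i < n" for i
  proof -
    have "Pos i \<in> letters n" "Neg i \<in> letters n" using that by (auto simp: letters_def)
    then show ?thesis
      using hl[of "Pos i"] hl[of "Neg i"] cancel[of "Pos i"] cancel[of "Neg i"] by (simp add: mult_2 mul ck dc)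
  qed
  have rel: "run m h ?e (at (words_code rs) j) = ?e" if "j < length rs" for j
  proof -
    have j: "rs ! j \<in> words n" "rs ! j \<in> R" using nth_mem[OF that] R by blast+
    then have "cl (rs ! j) = \<one>\<^bsub>G\<^esub>"
      using pres_rel.relator[of "[]" n "[]" "rs ! j" R] by (simp add: one_presented_group word_class_eq_iff)
    then show ?thesis using run[OF j(1)] that q.hom_one by simp
  qed
  \<comment> \<open>The image of the class is stable under
    \<open>s \<mapsto> p (\<phi> g) s p (\<psi> g)\<^sup>-\<^sup>1\<close> and its inverse, since
    \<open>y\<close> may be replaced by \<open>g y\<close> or \<open>g\<^sup>-\<^sup>1 y\<close>.
    This map takes the argument on the right to the one on the left.\<close>
  have shift: "col (p (\<phi> g) \<otimes>\<^bsub>Q\<^esub> s) \<longleftrightarrow> col (s \<otimes>\<^bsub>Q\<^esub> p (\<psi> g))" if g: "g \<in> carrier G" and s: "s \<in> carrier Q" for g s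
  proof
    assume "col (p (\<phi> g) \<otimes>\<^bsub>Q\<^esub> s)"
    then obtain y where y: "y \<in> carrier G" "p (\<phi> g) \<otimes>\<^bsub>Q\<^esub> s = p (\<phi> y \<otimes>\<^bsub>G\<^esub> cl u \<otimes>\<^bsub>G\<^esub> inv\<^bsub>G\<^esub> \<psi> y)"
      unfolding col_def by blast
    have "s \<otimes>\<^bsub>Q\<^esub> p (\<psi> g) = inv\<^bsub>Q\<^esub> p (\<phi> g) \<otimes>\<^bsub>Q\<^esub> (p (\<phi> g) \<otimes>\<^bsub>Q\<^esub> s) \<otimes>\<^bsub>Q\<^esub> p (\<psi> g)"
      using g s by (simp add: q.H.m_assoc)
    also have "\<dots> = p (\<phi> (inv\<^bsub>G\<^esub> g \<otimes>\<^bsub>G\<^esub> y) \<otimes>\<^bsub>G\<^esub> cl u \<otimes>\<^bsub>G\<^esub> inv\<^bsub>G\<^esub> \<psi> (inv\<^bsub>G\<^esub> g \<otimes>\<^bsub>G\<^esub> y))"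
      unfolding y(2) using g y(1) uv by (simp add: q.H.m_assoc q.H.inv_mult_group)
    finally show "col (s \<otimes>\<^bsub>Q\<^esub> p (\<psi> g))" unfolding col_def using g y(1) by blast
  next
    assume "col (s \<otimes>\<^bsub>Q\<^esub> p (\<psi> g))"
    then obtain y where y: "y \<in> carrier G" "s \<otimes>\<^bsub>Q\<^esub> p (\<psi> g) = p (\<phi> y \<otimes>\<^bsub>G\<^esub> cl u \<otimes>\<^bsub>G\<^esub> inv\<^bsub>G\<^esub> \<psi> y)"
      unfolding col_def by blast
    have "p (\<phi> g) \<otimes>\<^bsub>Q\<^esub> s = p (\<phi> g) \<otimes>\<^bsub>Q\<^esub> (s \<otimes>\<^bsub>Q\<^esub> p (\<psi> g)) \<otimes>\<^bsub>Q\<^esub> inv\<^bsub>Q\<^esub> p (\<psi> g)"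
      using g s by (simp add: q.H.m_assoc)
    also have "\<dots> = p (\<phi> (g \<otimes>\<^bsub>G\<^esub> y) \<otimes>\<^bsub>G\<^esub> cl u \<otimes>\<^bsub>G\<^esub> inv\<^bsub>G\<^esub> \<psi> (g \<otimes>\<^bsub>G\<^esub> y))"
      unfolding y(2) using g y(1) uv by (simp add: q.H.m_assoc q.H.inv_mult_group)
    finally show "col (p (\<phi> g) \<otimes>\<^bsub>Q\<^esub> s)" unfolding col_def using g y(1) by blast
  qed
  have colour: "at x (at (at m (run m h ?e (at (words_code ps) i))) s) = at x (at (at m s) (run m h ?e (at (words_code qs) i)))"
    if i: "i < n" and s: "s < k" for i s
  proof -
    have "length ps = n" "length qs = n" using phi psi by (simp_all add: endo_given_by_def)
    then have "run m h ?e (at (words_code ps) i) = c (p (\<phi> (cl [Pos i])))"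
      "run m h ?e (at (words_code qs) i) = c (p (\<psi> (cl [Pos i])))"
      using i by (simp_all add: run image_words images)
    then show ?thesis
      using shift[of "cl [Pos i]" "d s"] Pos_words[OF i] s by (simp add: mul ck dc dQ x)
  qed
  have "col (p (cl u))"
    unfolding col_def using uv by (intro bexI[of _ "\<one>\<^bsub>G\<^esub>"]) simp_all
  moreover have "\<not> col (p (cl v))"
  proof
    assume "col (p (cl v))"
    then obtain y where y: "y \<in> carrier G" "p (cl v) = p (\<phi> y \<otimes>\<^bsub>G\<^esub> cl u \<otimes>\<^bsub>G\<^esub> inv\<^bsub>G\<^esub> \<psi> y)"
      unfolding col_def by blast
    then have "p (cl v \<otimes>\<^bsub>G\<^esub> \<psi> y) = p (\<phi> y \<otimes>\<^bsub>G\<^esub> cl u)" using uv by (simp add: q.H.m_assoc)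
    then show False using sep[OF y(1)] by simp
  qed
  ultimately have ne: "at x (run m h ?e (word_code u)) \<noteq> at x (run m h ?e (word_code v))"
    using uv by (simp add: run ck dc x)
  have hk: "at h a < k" if "a < n + n" for a
  proof -
    obtain b where "a = letter_code b" using surj_letter_code by (metis surjD)
    then show ?thesis using that hl[of b] by (simp add: letter_code_less_iff ck)
  qed
  have "separating n (words_code rs) (words_code ps) (words_code qs) (word_code u) (word_code v) k ?e m h x"
    unfolding separating_def
    using inv rel colour ne hk
    by (intro conjI allI impI) (simp_all add: mul ck dc cd dQ q.H.m_assoc)
  then show ?thesis by blast
qed

lemma generate_presented_group:
  "generate (presented_group n R) ((\<lambda>i. word_class n R [Pos i]) ` {..<n}) = carrier (presented_group n R)"
    (is "generate ?G ?X = _")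
proof -
  interpret G: group ?G by (rule group_presented_group)
  have X: "?X \<subseteq> carrier ?G" by (auto simp: carrier_presented_group letters_def)
  have "word_class n R w \<in> generate ?G ?X" if "w \<in> words n" for w
    using that
  proof (induction rule: lists.induct)
    case Nil
    show ?case using generate.one[of ?G ?X] by (simp add: one_presented_group)
  next
    case (Cons a w)
    note a = Cons.hyps(1) and w = Cons.hyps(2)
    have P: "[Pos i] \<in> words n" "[Neg i] \<in> words n" if "i < n" for i using that by (auto simp: letters_def)
    have "word_class n R [a] \<in> generate ?G ?X"
    proof (cases a)
      case (Pos i)
      then show ?thesis using a by (intro generate.incl) (auto simp: letters_def)
    next
      case (Neg i)
      then have i: "i < n" using a by (auto simp: letters_def)
      have "word_class n R [Neg i] \<otimes>\<^bsub>?G\<^esub> word_class n R [Pos i] = \<one>\<^bsub>?G\<^esub>"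
        using pres_rel.cancel[of "[]" n "[]" "Neg i" R] P[OF i] i
        by (simp add: mult_word_class one_presented_group word_class_eq_iff)
      then have "inv\<^bsub>?G\<^esub> word_class n R [Pos i] = word_class n R [Neg i]"
        using P[OF i] by (intro G.inv_equality) (auto simp: carrier_presented_group)
      then show ?thesis using generate.inv[of "word_class n R [Pos i]" ?X ?G] i Neg by simp
    qed
    then have "word_class n R [a] \<otimes>\<^bsub>?G\<^esub> word_class n R w \<in> generate ?G ?X"
      using Cons.IH by (rule generate.eng)
    then show ?case using a w by (simp add: mult_word_class)
  qed
  then show ?thesis
    using G.generate_in_carrier[OF X] by (auto simp: carrier_presented_group)
qed

text \<open>Conjugating \<psi> by \<open>u\<close> absorbs \<open>u\<close>:
  \<open>(x\<phi>) u = v (x\<psi>)\<close> becomes \<open>x\<phi> = (v u\<^sup>-\<^sup>1) (u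
  (x\<psi>) u\<^sup>-\<^sup>1)\<close>, the form treated by
  \<open>twisted_conjugacy_separable\<close>. Nilpotency brings the chain down to the trivial
  subgroup.\<close>

lemma (in group) twisted_conjugacy_separable_nilpotent:
  assumes "nilpotent_of_class G c" "finite X" "X \<subseteq> carrier G" "generate G X = carrier G"
    and f: "\<phi> \<in> hom G G" and g: "\<psi> \<in> hom G G" and uv: "u \<in> carrier G" "v \<in> carrier G"
    and "\<not> twisted_conjugate G \<phi> \<psi> u v"
  shows "\<exists>N. N \<lhd> G \<and> finite_index N \<and> (\<forall>x\<in>carrier G. N #> (\<phi> x \<otimes> u) \<noteq> N #> (v \<otimes> \<psi> x))"
proof -
  interpret f: group_hom G G \<phi> using f by unfold_locales
  interpret g: group_hom G G \<psi> using g by unfold_locales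
  let ?\<psi> = "\<lambda>x. u \<otimes> \<psi> x \<otimes> inv u" and ?w = "v \<otimes> inv u"
  have shift: "N #> (\<phi> x \<otimes> u) = N #> (v \<otimes> \<psi> x) \<longleftrightarrow> N #> \<phi> x = N #> (?w \<otimes> ?\<psi> x)"
    if "subgroup N G" "x \<in> carrier G" for N x
    using that uv by (simp add: rcos_eq_iff inv_mult_group m_assoc)
  have "lower_central G c = {\<one>}" using assms(1) by (simp add: nilpotent_of_class_def)
  then have chain: "central_cyclic_chain {\<one>}"
    using central_cyclic_chain_lower_central[OF assms(2-4), of c] by simp
  have hom: "group_hom G G ?\<psi>"
    by unfold_locales (use uv in \<open>auto intro!: homI simp: m_assoc\<close>)
  have "\<forall>x\<in>carrier G. {\<one>} #> \<phi> x \<noteq> {\<one>} #> (?w \<otimes> ?\<psi> x)"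
  proof
    fix x assume x: "x \<in> carrier G"
    then have "\<phi> x \<otimes> u \<noteq> v \<otimes> \<psi> x" using assms(9) by (auto simp: twisted_conjugate_def)
    then have "{\<one>} #> (\<phi> x \<otimes> u) \<noteq> {\<one>} #> (v \<otimes> \<psi> x)" using x uv by (simp add: r_coset_def)
    then show "{\<one>} #> \<phi> x \<noteq> {\<one>} #> (?w \<otimes> ?\<psi> x)" using shift[OF triv_subgroup x] by simp
  qed
  then obtain N where N: "N \<lhd> G" "finite_index N" "\<forall>x\<in>carrier G. N #> \<phi> x \<noteq> N #> (?w \<otimes> ?\<psi> x)"
    using twisted_conjugacy_separable[OF chain f.group_hom_axioms hom subgroup_self, of ?w] uv by auto
  then show ?thesis using shift[OF normal_imp_subgroup[OF N(1)]] by blast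
qed

section \<open>Enumerability of both answers, and the algorithm\<close>

lemmas recursive_intros =
  recursive_id recursive_const recursive_Suc recursive_add recursive_pair recursive_pfst recursive_psnd
  recursive_at recursive_len recursive_appendc recursive_rec_nat

lemmas decidable_intros = decidable_not decidable_conj decidable_disj decidable_ball decidable_less decidable_eq

abbreviation (input) arg0 :: "nat \<Rightarrow> nat" where "arg0 e \<equiv> pfst e"
abbreviation (input) arg1 :: "nat \<Rightarrow> nat" where "arg1 e \<equiv> pfst (psnd e)"
abbreviation (input) arg2 :: "nat \<Rightarrow> nat" where "arg2 e \<equiv> pfst (psnd (psnd e))"
abbreviation (input) arg3 :: "nat \<Rightarrow> nat" where "arg3 e \<equiv> pfst (psnd (psnd (psnd e)))"
abbreviation (input) arg4 :: "nat \<Rightarrow> nat" where "arg4 e \<equiv> pfst (psnd (psnd (psnd (psnd e))))"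
abbreviation (input) arg5 :: "nat \<Rightarrow> nat" where "arg5 e \<equiv> psnd (psnd (psnd (psnd (psnd e))))"

text \<open>Enumerability is enough for the reflexive transitive closure, so the ways to split a
  word can be quantified over without bounds.\<close>

lemma enumerable_code_step:
  assumes "recursive a" "recursive b" "recursive c" "recursive d" "recursive x" "recursive y"
  shows "enumerable (\<lambda>e. code_step (a e) (b e) (c e) (d e) (x e) (y e))"
  unfolding code_step_def is_relation_def is_word_def pair_code_def
  by (intro enumerable_disj enumerable_ex enumerable_conj;
      rule decidable_imp_enumerable, intro decidable_intros recursive_intros assms[THEN recursive_compose] assms)

lemma enumerable_conj_eq:
  "enumerable (\<lambda>e. (\<lambda>x y. code_step (arg0 e) (arg1 e) (arg2 e) (arg3 e) x y \<or>
      code_step (arg0 e) (arg1 e) (arg2 e) (arg3 e) y x)\<^sup>*\<^sup>* (arg4 e) (arg5 e))"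
  by (intro enumerable_rtranclp enumerable_disj enumerable_code_step recursive_intros)

lemma enumerable_separating:
  "enumerable (\<lambda>e. \<exists>k i m h x. separating (arg0 e) (arg1 e) (arg2 e) (arg3 e) (arg4 e) (arg5 e) k i m h x)"
  unfolding separating_def run_def
  by (intro enumerable_ex; rule decidable_imp_enumerable, intro decidable_intros recursive_intros)

theorem theorem3p1:
  shows "\<exists>alg :: recf. \<forall>(n :: nat) (rs :: word list) (c :: nat)
      (ps :: word list) (qs :: word list) (\<phi> :: word set \<Rightarrow> word set) (\<psi> :: word set \<Rightarrow> word set)
      (u :: word) (v :: word).
    set rs \<subseteq> words n \<longrightarrow>
    c \<ge> 1 \<longrightarrow> nilpotent_of_class (presented_group n (set rs)) c \<longrightarrow>
    endo_given_by n (set rs) ps \<phi> \<longrightarrow> endo_given_by n (set rs) qs \<psi> \<longrightarrow>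
    u \<in> words n \<longrightarrow> v \<in> words n \<longrightarrow>
    computes alg
      [n, words_code rs, words_code ps, words_code qs, word_code u, word_code v]
      (if twisted_conjugate (presented_group n (set rs)) \<phi> \<psi>
            (word_class n (set rs) u) (word_class n (set rs) v)
       then 1 else 0)"
proof -
  define P where "P e \<longleftrightarrow> (\<lambda>x y. code_step (arg0 e) (arg1 e) (arg2 e) (arg3 e) x y \<or>
      code_step (arg0 e) (arg1 e) (arg2 e) (arg3 e) y x)\<^sup>*\<^sup>* (arg4 e) (arg5 e)" for e
  define Q where "Q e \<longleftrightarrow> (\<exists>k i m h x.
      separating (arg0 e) (arg1 e) (arg2 e) (arg3 e) (arg4 e) (arg5 e) k i m h x)" for e
  obtain p where p: "\<And>e. (P e \<longleftrightarrow> \<not> Q e) \<Longrightarrow> computes p [e] (of_bool (P e))"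
    using computes_of_enumerable[OF enumerable_conj_eq enumerable_separating] unfolding P_def Q_def by blast
  obtain pp where pp: "\<And>x y. computes pp [x, y] (prod_encode (x, y))"
    using recursive2_prod_encode unfolding recursive2_def by blast
  \<comment> \<open>The six inputs are packed into one iterated pair, in the order in which
    \<open>arg0\<close> to \<open>arg5\<close> read them.\<close>
  let ?alg = "Comp p [Comp pp [Proj 0, Comp pp [Proj 1, Comp pp [Proj 2, Comp pp [Proj 3, Comp pp [Proj 4, Proj 5]]]]]]"
  show ?thesis
  proof (intro exI[of _ ?alg] allI impI)
    fix n rs c ps qs \<phi> \<psi> u v
    assume rs: "set rs \<subseteq> words n" and nil: "nilpotent_of_class (presented_group n (set rs)) c"
      and endo: "endo_given_by n (set rs) ps \<phi>" "endo_given_by n (set rs) qs \<psi>"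
      and uv: "u \<in> words n" "v \<in> words n"
    interpret E: endomorphism_pair n "set rs" ps qs \<phi> \<psi> using endo by unfold_locales
    define e where "e = prod_encode (n, prod_encode (words_code rs, prod_encode (words_code ps,
      prod_encode (words_code qs, prod_encode (word_code u, word_code v)))))"
    have len: "length ps = n" "length qs = n" "set ps \<subseteq> words n" "set qs \<subseteq> words n"
      using endo by (simp_all add: endo_given_by_def)
    let ?tc = "twisted_conjugate E.G \<phi> \<psi> (E.cl u) (E.cl v)"
    have P: "P e \<longleftrightarrow> ?tc"
      unfolding P_def e_def using code_step_rtranclp[OF len(1,2)] E.twisted_conjugate_iff_conj_eq[OF uv] by simp
    have Qe: "Q e \<longleftrightarrow> (\<exists>k i m h x.
        separating n (words_code rs) (words_code ps) (words_code qs) (word_code u) (word_code v) k i m h x)"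
      unfolding Q_def e_def by simp
    have "\<not> ?tc" if "Q e"
      using that separating_not_conj_eq[OF _ len uv(1)] E.twisted_conjugate_iff_conj_eq[OF uv] unfolding Qe by blast
    \<comment> \<open>Nilpotency enters here, through the existence of a certificate; the program
      itself does not receive the class \<open>c\<close>.\<close>
    moreover have "Q e" if ntc: "\<not> ?tc"
    proof -
      have X: "finite ((\<lambda>i. E.cl [Pos i]) ` {..<n})" "(\<lambda>i. E.cl [Pos i]) ` {..<n} \<subseteq> carrier E.G"
        using E.Pos_words by auto
      obtain N where N: "N \<lhd> E.G \<and> E.G.finite_index N \<and>
          (\<forall>x\<in>carrier E.G. N #>\<^bsub>E.G\<^esub> (\<phi> x \<otimes>\<^bsub>E.G\<^esub> E.cl u) \<noteq> N #>\<^bsub>E.G\<^esub> (E.cl v \<otimes>\<^bsub>E.G\<^esub> \<psi> x))"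
        using E.G.twisted_conjugacy_separable_nilpotent[OF nil X generate_presented_group E.hom
              E.cl_carrier[OF uv(1)] E.cl_carrier[OF uv(2)] ntc] ..
      have "group_hom E.G (E.G Mod N) ((#>\<^bsub>E.G\<^esub>) N)"
        using conjunct1[OF N] normal.factorgroup_is_group normal.r_coset_hom_Mod
        by (metis E.G.group_axioms group_hom.intro group_hom_axioms.intro)
      moreover have "finite (carrier (E.G Mod N))"
        using N by (simp add: carrier_FactGroup E.G.finite_index_def)
      ultimately show ?thesis unfolding Qe using N by (intro E.ex_separating[OF _ _ HOL.refl rs uv]) blast+
    qed
    ultimately have "computes p [e] (of_bool (P e))" using P by (intro p) blast
    moreover have "computes (Comp pp [Proj 0, Comp pp [Proj 1, Comp pp [Proj 2, Comp pp [Proj 3, Comp pp [Proj 4, Proj 5]]]]])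
        [n, words_code rs, words_code ps, words_code qs, word_code u, word_code v] e"
      unfolding e_def by (intro computes_Comp2[OF _ _ pp] computes_Proj) simp_all
    ultimately have "computes ?alg [n, words_code rs, words_code ps, words_code qs, word_code u, word_code v] (of_bool ?tc)"
      unfolding P by (intro computes_Comp1)
    then show "computes ?alg [n, words_code rs, words_code ps, words_code qs, word_code u, word_code v]
        (if ?tc then 1 else 0)" by (simp add: of_bool_def)
  qed
qed

end
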